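(* Let $t_0>0$, $\alpha>0$, let $\beta:[t_0,+\infty)\to(0,+\infty)$ be continuously differentiable and non-decreasing, let $x_0,v_0\in\mathbb{R}^n$, let $L>0$, and let $f_1,\dots,f_m:\mathbb{R}^n\to\mathbb{R}$ be convex and differentiable with $L$-Lipschitz continuous gradients. Then there exists a function $x:[t_0,+\infty)\to\mathbb{R}^n$ which is a solution of (MITS) with $x(t_0)=x_0$ and $\dot x(t_0)=v_0$.
   Context: $\mathbb{R}^n$ carries the Euclidean inner product $\langle\cdot,\cdot\rangle$ and norm $\|\cdot\|$. For $x\in\mathbb{R}^n$, $C(x):=\mathrm{co}\{\nabla f_i(x): i=1,\dots,m\}$ (convex hull), and for a nonempty closed convex set $K$, $\mathrm{Proj}_K(y)$ is the Euclidean projection of $y$ onto $K$. (MITS) is the equation $$\frac{\alpha}{t}\dot x(t)+\mathrm{Proj}_{\beta(t)C(x(t))+\ddot x(t)}(0)=0,$$ equivalently $\ddot x(t)+\frac{\alpha}{t}\dot x(t)+\mathrm{Proj}_{\beta(t)C(x(t))}(-\ddot x(t))=0$. A function $x:[t_0,+\infty)\to\mathbb{R}^n$ is a solution of (MITS) with initial data $(x_0,v_0)$ if: (i) $x\in C^1([t_0,+\infty))$; (ii) $\dot x$ is absolutely continuous on $[t_0,T]$ for every $T\ge t_0$; (iii) there is a measurable function $\ddot x:[t_0,+\infty)\to\mathbb{R}^n$ with $\dot x(t)=\dot x(t_0)+\int_{t_0}^t\ddot x(s)\,ds$ for all $t\ge t_0$; (iv) $\dot x$ is differentiable almost everywhere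 and $\frac{d}{dt}\dot x(t)=\ddot x(t)$ for almost all $t\ge t_0$; (v) $\ddot x(t)+\frac{\alpha}{t}\dot x(t)+\mathrm{Proj}_{\beta(t)C(x(t))}(-\ddot x(t))=0$ for almost all $t\ge t_0$; (vi) $x(t_0)=x_0$ and $\dot x(t_0)=v_0$. *)

theory Defs
  imports "HOL-Analysis.Analysis"
begin

definition gradient :: "('a::real_inner \<Rightarrow> real) \<Rightarrow> 'a \<Rightarrow> 'a" where
  "gradient f x = (THE D. GDERIV f x :> D)"

lemma gradient_eqI: "GDERIV f x :> D \<Longrightarrow> gradient f x = D"
  unfolding gradient_def
proof (rule the_equality)
  fix E assume "GDERIV f x :> D" and "GDERIV f x :> E"
  then have "(\<lambda>h. inner h E) = (\<lambda>h. inner h D)"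
    unfolding gderiv_def by (rule has_derivative_unique[rotated])
  then show "E = D"
    by (metis inner_commute vector_eq_ldot)
qed

(* Derivatives are taken within S, hence one-sided at the left end point of {t0..};
   the library's C1_differentiable_on asks for a two-sided derivative at every point of S,
   which is not meaningful for a function given on {t0..} only. *)
definition continuously_differentiable_on ::
    "real set \<Rightarrow> (real \<Rightarrow> 'a::real_normed_vector) \<Rightarrow> bool" where
  "continuously_differentiable_on S g \<longleftrightarrow>
     (\<forall>t\<in>S. g differentiable (at t within S)) \<and>
     continuous_on S (\<lambda>t. vector_derivative g (at t within S))"

definition abs_continuous_on_interval ::
    "real \<Rightarrow> real \<Rightarrow> (real \<Rightarrow> 'a::real_normed_vector) \<Rightarrow> bool" where
  "abs_continuous_on_interval a b g \<longleftrightarrow>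
     (\<forall>\<epsilon>>0. \<exists>\<delta>>0. \<forall>(k::nat) (u::nat \<Rightarrow> real) (v::nat \<Rightarrow> real).
        (\<forall>i<k. a \<le> u i \<and> u i \<le> v i \<and> v i \<le> b) \<and>
        disjoint_family_on (\<lambda>i. {u i<..<v i}) {..<k} \<and>
        (\<Sum>i<k. v i - u i) < \<delta> \<longrightarrow>
        (\<Sum>i<k. norm (g (v i) - g (u i))) < \<epsilon>)"

definition grad_hull :: "nat \<Rightarrow> (nat \<Rightarrow> 'a::real_inner \<Rightarrow> real) \<Rightarrow> 'a \<Rightarrow> 'a set" where
  "grad_hull m f y = convex hull ((\<lambda>i. gradient (f i) y) ` {1..m})"

(* Only the values of x on {t0..} matter; xdot is the derivative of x within {t0..}, and
   a plays the role of the second derivative of x.  The integrability conjunct is implicit in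
   writing the integral of a, whose value is 0 by convention for non-integrable functions. *)
definition MITS_solution ::
    "real \<Rightarrow> real \<Rightarrow> (real \<Rightarrow> real) \<Rightarrow> nat \<Rightarrow> (nat \<Rightarrow> 'a::euclidean_space \<Rightarrow> real) \<Rightarrow>
     'a \<Rightarrow> 'a \<Rightarrow> (real \<Rightarrow> 'a) \<Rightarrow> bool" where
  "MITS_solution t0 \<alpha> \<beta> m f x0 v0 x \<longleftrightarrow>
     (let xdot = (\<lambda>t. vector_derivative x (at t within {t0..})) in
        continuously_differentiable_on {t0..} x \<and>
        (\<forall>T\<ge>t0. abs_continuous_on_interval t0 T xdot) \<and>
        (\<exists>a. a \<in> borel_measurable (lebesgue_on {t0..}) \<and>
             (\<forall>t\<ge>t0. set_integrable lebesgue {t0..t} a \<and>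
                     xdot t = xdot t0 + (LINT s:{t0..t}|lebesgue. a s)) \<and>
             (AE t in lebesgue_on {t0..}.
                (xdot has_vector_derivative a t) (at t within {t0..})) \<and>
             (AE t in lebesgue_on {t0..}.
                a t + (\<alpha> / t) *\<^sub>R xdot t +
                closest_point ((\<lambda>c. \<beta> t *\<^sub>R c) ` grad_hull m f (x t)) (- a t) = 0)) \<and>
        x t0 = x0 \<and> xdot t0 = v0)"

end

theory Submission
  imports Defs
begin

text \<open>
  Write \<open>u\<close> for the velocity of \<open>x\<close>. A point \<open>p\<close> of \<open>K = \<beta>(t) C(x)\<close> is the projection of \<open>-u'\<close> with
  \<open>u' + (\<alpha>/t) u + p = 0\<close> iff \<open>p\<close> maximizes the inner product with \<open>u\<close> over \<open>K\<close>. So (MITS) is the first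
  order inclusion \<open>u' \<in> - (\<alpha>/t) u - argmax\<^bsub>K\<^esub> u\<close> for the pair \<open>(x, u)\<close>, whose right-hand side is upper
  semicontinuous with compact convex values and grows at most linearly.

  Choose a maximizing gradient arbitrarily and run Euler's scheme. The Euler curves are locally bounded
  and asymptotically Lipschitz, so they have a locally Lipschitz cluster point. Difference quotients of
  Euler curves are averages of values of the selection; hence, wherever the limit is differentiable, its
  derivative lies in the convex hull of the values selected nearby, which is the right-hand side.

  There remains the a.e. differentiability of a Lipschitz function \<open>u\<close>. Henstock's lemma and a Vitali
  covering show that an indefinite integral is a.e. differentiable. If \<open>g\<close> is the upper limit of the
  quotients \<open>n (u(t + 1/n) - u(t))\<close>, then \<open>u - \<integral>g\<close> has a nonnegative right derivate a.e. and so is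
  nondecreasing; the same argument for \<open>-u\<close> and the lower limit gives the reverse inequality, so that
  \<open>u - \<integral>g\<close> is constant.
\<close>

subsection \<open>Almost everywhere differentiability of Lipschitz functions\<close>

text \<open>At a bad point there are arbitrarily short intervals on which the Riemann term misses
  the integral by more than \<open>e\<close> times the length. Vitali extracts disjoint ones,
  Henstock's lemma bounds their total error and hence their total length, and their fivefold
  enlargements cover the bad set.\<close>

lemma negligible_integral_not_differentiable:
  fixes g :: "real \<Rightarrow> 'a::euclidean_space"
  assumes g: "g integrable_on {a..b}"
  shows "negligible {x\<in>{a<..<b}. \<not> ((\<lambda>t. integral {a..t} g) has_vector_derivative g x) (at x)}"
proof -
  define G where "G \<equiv> \<lambda>t. integral {a..t} g"
  define S where "S \<equiv> \<lambda>e. {x\<in>{a<..<b}. \<forall>d>0. \<exists>y\<in>{a<..<b}.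
      0 < \<bar>y - x\<bar> \<and> \<bar>y - x\<bar> < d \<and> e * \<bar>y - x\<bar> < norm (G y - G x - (y - x) *\<^sub>R g x)}"
  have G_diff: "integral {x..y} g = G y - G x" if "a \<le> x" "x \<le> y" "y \<le> b" for x y
  proof -
    have "g integrable_on {a..y}"
      using g that by (auto intro: integrable_subinterval_real)
    then show ?thesis
      using Henstock_Kurzweil_Integration.integral_combine[of a x y g] that by (simp add: G_def algebra_simps)
  qed
  have "negligible (S e)" if "e > 0" for e
    unfolding negligible_outer_le
  proof (intro allI impI)
    fix \<eta> :: real
    assume "\<eta> > 0"
    \<comment> \<open>In the tolerance, the factor \<open>e\<close> converts total error into total
      length, and the divisor 5 pays for the Vitali enlargement.\<close>
    obtain \<gamma> where \<gamma>: "gauge \<gamma>"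
      and Henstock: "\<And>p. \<lbrakk>p tagged_partial_division_of (cbox a b); \<gamma> fine p\<rbrakk> \<Longrightarrow>
             sum (\<lambda>(x,k). norm (measure lborel k *\<^sub>R g x - integral k g)) p < e * \<eta> / 5"
      using Henstock_lemma[of g a b "e * \<eta> / 5"] g \<open>e > 0\<close> \<open>\<eta> > 0\<close> by auto
    have "\<exists>y\<in>{a<..<b}. 0 < \<bar>y - x\<bar> \<and> cbox (min x y) (max x y) \<subseteq> \<gamma> x \<and>
        e * \<bar>y - x\<bar> < norm (G y - G x - (y - x) *\<^sub>R g x)" if "x \<in> S e" for x
    proof -
      obtain d where "d > 0" and d: "ball x d \<subseteq> \<gamma> x"
        using \<gamma> by (meson gaugeD open_contains_ball)
      obtain y where y: "y \<in> {a<..<b}" "0 < \<bar>y - x\<bar>" "\<bar>y - x\<bar> < d"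
          "e * \<bar>y - x\<bar> < norm (G y - G x - (y - x) *\<^sub>R g x)"
        using \<open>x \<in> S e\<close> \<open>d > 0\<close> unfolding S_def by blast
      moreover have "cbox (min x y) (max x y) \<subseteq> ball x d"
        using y(3) by (auto simp: dist_real_def abs_if min_def max_def split: if_splits)
      ultimately show ?thesis
        using d by blast
    qed
    then obtain Y where Y: "\<And>x. x \<in> S e \<Longrightarrow> Y x \<in> {a<..<b} \<and> 0 < \<bar>Y x - x\<bar> \<and>
        cbox (min x (Y x)) (max x (Y x)) \<subseteq> \<gamma> x \<and>
        e * \<bar>Y x - x\<bar> < norm (G (Y x) - G x - (Y x - x) *\<^sub>R g x)"
      by metis
    \<comment> \<open>The interval between \<open>x\<close> and \<open>Y x\<close> is recast as a
      ball, the form required by the covering lemma. \<open>Y x\<close> may lie on either side of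
      \<open>x\<close>, hence \<open>min\<close> and \<open>max\<close>.\<close>
    define c r where "c \<equiv> \<lambda>x. (x + Y x) / 2" and "r \<equiv> \<lambda>x. \<bar>Y x - x\<bar> / 2"
    have cball_eq: "cball (c x) (r x) = cbox (min x (Y x)) (max x (Y x))" for x
      unfolding c_def r_def cball_eq_atLeastAtMost by (auto simp: field_simps min_def max_def abs_if)
    have "S e \<subseteq> (\<Union>x\<in>S e. cball (c x) (r x))"
      unfolding cball_eq by fastforce
    moreover have "0 < r x \<and> r x \<le> b - a" if "x \<in> S e" for x
      using Y[OF that] that by (auto simp: r_def S_def abs_if)
    ultimately obtain C where C: "countable C" "C \<subseteq> S e"
      and disj: "pairwise (\<lambda>i j. disjnt (cball (c i) (r i)) (cball (c j) (r j))) C"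
      and cov: "S e \<subseteq> (\<Union>i\<in>C. cball (c i) (5 * r i))"
      by (rule Vitali_covering_lemma_cballs[where K = "S e"])
    have bound: "measure lebesgue (\<Union>i\<in>F. cball (c i) (5 * r i)) \<le> \<eta>" if F: "F \<subseteq> C" "finite F" for F
    proof -
      \<comment> \<open>Each chosen interval is tagged by its end point \<open>x\<close>, so the
        Henstock term at \<open>x\<close> is exactly the error that defines
        \<open>S e\<close>.\<close>
      define p where "p \<equiv> (\<lambda>x. (x, cbox (min x (Y x)) (max x (Y x)))) ` F"
      have FS: "x \<in> S e" if "x \<in> F" for x
        using that F C by blast
      have "p tagged_partial_division_of (cbox a b)"
        unfolding tagged_partial_division_of_def
      proof (intro conjI allI impI)
        show "finite p"
          using F by (simp add: p_def)
      next
        fix x K assume "(x, K) \<in> p"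
        then have x: "x \<in> F" and K: "K = cbox (min x (Y x)) (max x (Y x))"
          by (auto simp: p_def)
        show "x \<in> K"
          by (auto simp: K)
        show "K \<subseteq> cbox a b"
          using Y[OF FS[OF x]] FS[OF x] by (auto simp: K S_def)
        show "\<exists>a b. K = cbox a b"
          using K by blast
      next
        fix x1 K1 x2 K2
        assume "(x1, K1) \<in> p \<and> (x2, K2) \<in> p \<and> (x1, K1) \<noteq> (x2, K2)"
        then have "x1 \<in> F" "x2 \<in> F" "x1 \<noteq> x2" and K: "K1 = cball (c x1) (r x1)" "K2 = cball (c x2) (r x2)"
          by (auto simp: p_def cball_eq)
        then have "disjnt K1 K2"
          using disj F unfolding pairwise_def by blast
        then show "interior K1 \<inter> interior K2 = {}"
          using interior_subset by (fastforce simp: disjnt_def)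
      qed
      moreover have "\<gamma> fine p"
        using Y FS by (auto simp: fine_def p_def)
      ultimately have "sum (\<lambda>(x,k). norm (measure lborel k *\<^sub>R g x - integral k g)) p < e * \<eta> / 5"
        by (rule Henstock)
      also have "sum (\<lambda>(x,k). norm (measure lborel k *\<^sub>R g x - integral k g)) p =
          (\<Sum>x\<in>F. norm (G (Y x) - G x - (Y x - x) *\<^sub>R g x))"
        unfolding p_def
      proof (subst sum.reindex, force simp: inj_on_def, rule sum.cong[OF refl])
        fix x assume "x \<in> F"
        then have x: "x \<in> {a<..<b}" "Y x \<in> {a<..<b}"
          using FS[of x] Y[of x] by (auto simp: S_def)
        show "((\<lambda>(x,k). norm (measure lborel k *\<^sub>R g x - integral k g)) \<circ>
            (\<lambda>x. (x, cbox (min x (Y x)) (max x (Y x))))) x =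
            norm (G (Y x) - G x - (Y x - x) *\<^sub>R g x)"
        proof (cases "x \<le> Y x")
          case True
          then show ?thesis
            using G_diff[of x "Y x"] x by (simp add: min_def max_def norm_minus_commute)
        next
          case False
          have "norm ((x - Y x) *\<^sub>R g x - (G x - G (Y x))) = norm (G (Y x) - G x - (Y x - x) *\<^sub>R g x)"
            by (rule arg_cong[where f=norm]) (simp add: algebra_simps)
          with False show ?thesis
            using G_diff[of "Y x" x] x by (simp add: min_def max_def)
        qed
      qed
      finally have "(\<Sum>x\<in>F. norm (G (Y x) - G x - (Y x - x) *\<^sub>R g x)) < e * \<eta> / 5" .
      moreover have "(\<Sum>x\<in>F. e * \<bar>Y x - x\<bar>) \<le> (\<Sum>x\<in>F. norm (G (Y x) - G x - (Y x - x) *\<^sub>R g x))"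
        using Y FS by (intro sum_mono) (meson less_imp_le)
      ultimately have "e * (\<Sum>x\<in>F. \<bar>Y x - x\<bar>) < e * (\<eta> / 5)"
        by (simp add: sum_distrib_left)
      then have "(\<Sum>x\<in>F. \<bar>Y x - x\<bar>) < \<eta> / 5"
        using \<open>e > 0\<close> mult_less_cancel_left_pos by blast
      moreover have "measure lebesgue (\<Union>i\<in>F. cball (c i) (5 * r i)) \<le> (\<Sum>i\<in>F. measure lebesgue (cball (c i) (5 * r i)))"
        using F by (intro measure_UNION_le) auto
      moreover have "measure lebesgue (cball (c i) (5 * r i)) = 5 * \<bar>Y i - i\<bar>" for i
        unfolding cball_eq_atLeastAtMost by (simp add: r_def)
      ultimately show ?thesis
        by (simp flip: sum_distrib_left)
    qed
    have "(\<Union>i\<in>C. cball (c i) (5 * r i)) \<in> lmeasurable"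
      "measure lebesgue (\<Union>i\<in>C. cball (c i) (5 * r i)) \<le> \<eta>"
      by (intro fmeasurable_UN_bound[OF C(1) _ bound] measure_UN_bound[OF C(1) _ bound]; simp)+
    with cov show "\<exists>T. S e \<subseteq> T \<and> T \<in> lmeasurable \<and> measure lebesgue T \<le> \<eta>"
      by blast
  qed
  then have "negligible (\<Union>n. S (1 / real (Suc n)))"
    by (intro negligible_countable_Union) auto
  then show ?thesis
  proof (rule negligible_subset, intro subsetI)
    fix x assume "x \<in> {x\<in>{a<..<b}. \<not> ((\<lambda>t. integral {a..t} g) has_vector_derivative g x) (at x)}"
    then have x: "x \<in> {a<..<b}" and nd: "\<not> (G has_vector_derivative g x) (at x)"
      by (auto simp: G_def[abs_def])
    obtain e where "e > 0" and e: "\<And>d. d > 0 \<Longrightarrow> \<exists>y. \<bar>y - x\<bar> < d \<and> e * \<bar>y - x\<bar> < norm (G y - G x - (y - x) *\<^sub>R g x)"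
      using nd bounded_linear_scaleR_left unfolding has_vector_derivative_def has_derivative_at_alt
      by (auto simp: not_le)
    obtain n where n: "1 / real (Suc n) < e"
      using \<open>e > 0\<close> nat_approx_posE by metis
    have "x \<in> S (1 / real (Suc n))"
      unfolding S_def
    proof (intro CollectI conjI allI impI x)
      fix d :: real assume "d > 0"
      then have "min d (min (x - a) (b - x)) > 0"
        using x by auto
      then obtain y where y: "\<bar>y - x\<bar> < min d (min (x - a) (b - x))"
        "e * \<bar>y - x\<bar> < norm (G y - G x - (y - x) *\<^sub>R g x)"
        using e by blast
      have "1 / real (Suc n) * \<bar>y - x\<bar> \<le> e * \<bar>y - x\<bar>"
        using n by (intro mult_right_mono) auto
      moreover have "0 < \<bar>y - x\<bar>"
        using y(2) by (cases "y = x") auto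
      ultimately show "\<exists>y\<in>{a<..<b}. 0 < \<bar>y - x\<bar> \<and> \<bar>y - x\<bar> < d \<and>
          1 / real (Suc n) * \<bar>y - x\<bar> < norm (G y - G x - (y - x) *\<^sub>R g x)"
        using y by (intro bexI[of _ y]) auto
    qed
    then show "x \<in> (\<Union>n. S (1 / real (Suc n)))"
      by blast
  qed
qed

text \<open>The set where \<open>k\<close> is at least \<open>k a\<close> is compact, so it has a
  last point; before \<open>b\<close>, the hypothesis would supply a later one.\<close>

lemma le_if_locally_nondecreasing:
  fixes k :: "real \<Rightarrow> real"
  assumes "a \<le> b" and cont: "continuous_on {a..b} k"
    and incr: "\<And>x. x \<in> {a..<b} \<Longrightarrow> \<exists>v\<in>{x<..b}. k x \<le> k v"
  shows "k a \<le> k b"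
proof -
  define S where "S = {a..b} \<inter> k -` {k a..}"
  have "compact S"
  proof -
    have "closed S"
      unfolding S_def by (intro continuous_closed_preimage cont) auto
    moreover have "bounded S"
      unfolding S_def by (meson bounded_closed_interval bounded_subset inf_le1)
    ultimately show ?thesis
      by (simp add: compact_eq_bounded_closed)
  qed
  moreover have "a \<in> S"
    using \<open>a \<le> b\<close> by (simp add: S_def)
  ultimately obtain s where s: "s \<in> S" and max: "\<And>t. t \<in> S \<Longrightarrow> t \<le> s"
    using compact_attains_sup[of S] by blast
  have "s = b"
  proof (rule ccontr)
    assume "s \<noteq> b"
    then have "s \<in> {a..<b}"
      using s by (auto simp: S_def)
    then obtain v where "v \<in> {s<..b}" "k s \<le> k v"
      using incr by blast
    then have "v \<in> S"
      using s by (auto simp: S_def)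
    then show False
      using max \<open>v \<in> {s<..b}\<close> by force
  qed
  then show ?thesis
    using s by (simp add: S_def)
qed

text \<open>Adding to \<open>h\<close> a small linear term and \<open>M\<close> times the measure of
  an open neighbourhood of \<open>N\<close> up to \<open>x\<close> makes it locally nondecreasing at
  every point. Both additions shrink to zero with \<open>c\<close>.\<close>

lemma le_if_right_derivate_nonneg_ae:
  fixes h :: "real \<Rightarrow> real"
  assumes "a \<le> b" and lip: "M-lipschitz_on {a..b} h" and N: "negligible N"
    and incr: "\<And>x c. x \<in> {a..<b} \<Longrightarrow> x \<notin> N \<Longrightarrow> c > 0 \<Longrightarrow> \<exists>v\<in>{x<..b}. - c * (v - x) \<le> h v - h x"
  shows "h a \<le> h b"
proof -
  have "M \<ge> 0"
    using lip by (rule lipschitz_on_nonneg)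
  have main: "h a \<le> h b + c * (M + b - a)" if "c > 0" for c
  proof -
    \<comment> \<open>As \<open>N\<close> is null, the open set \<open>T\<close> itself has measure
      below \<open>c\<close>; this later bounds \<open>\<psi> b\<close>.\<close>
    obtain T where T: "open T" "N \<subseteq> T" "T - N \<in> lmeasurable" "emeasure lebesgue (T - N) < ennreal c"
      using sets_lebesgue_outer_open[of N c] N \<open>c > 0\<close> negligible_imp_sets by blast
    define \<psi> where "\<psi> \<equiv> \<lambda>t. measure lebesgue (T \<inter> {a..t})"
    have T_sets: "T \<in> sets lebesgue"
      using T(1) by simp
    have meas: "T \<inter> {u..v} \<in> lmeasurable" "T \<inter> {u<..v} \<in> lmeasurable" for u v
    proof -
      show "T \<inter> {u..v} \<in> lmeasurable"
        by (rule fmeasurableI2[of "{u..v}"]) (use T_sets in auto)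
      then show "T \<inter> {u<..v} \<in> lmeasurable"
        by (rule fmeasurableI2) (use T_sets in auto)
    qed
    have \<psi>_diff: "\<psi> y - \<psi> x = measure lebesgue (T \<inter> {x<..y})" if "a \<le> x" "x \<le> y" for x y
    proof -
      have "T \<inter> {a..y} = T \<inter> {a..x} \<union> T \<inter> {x<..y}"
        using that by auto
      moreover have "measure lebesgue (T \<inter> {a..x} \<union> T \<inter> {x<..y}) =
          measure lebesgue (T \<inter> {a..x}) + measure lebesgue (T \<inter> {x<..y})"
        using meas[THEN fmeasurableD] meas[THEN fmeasurableD2]
        by (intro measure_Union) (simp_all only: infinity_ennreal_def, auto)
      ultimately show ?thesis
        by (simp add: \<psi>_def)
    qed
    have \<psi>_diff_le: "\<psi> y - \<psi> x \<le> y - x" if "a \<le> x" "x \<le> y" for x y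
    proof -
      have "measure lebesgue (T \<inter> {x<..y}) \<le> measure lebesgue {x..y}"
        by (rule measure_mono_fmeasurable) (use meas(2) in \<open>auto intro: fmeasurableD\<close>)
      then show ?thesis
        using \<psi>_diff[OF that] that by simp
    qed
    have \<psi>_mono: "\<psi> x \<le> \<psi> y" if "a \<le> x" "x \<le> y" for x y
      using \<psi>_diff[OF that] measure_nonneg[of lebesgue "T \<inter> {x<..y}"] by linarith
    \<comment> \<open>The growth of \<open>\<psi>\<close> inside \<open>T\<close> compensates any decrease of \<open>h\<close> at points of \<open>N\<close>.\<close>
    define k where "k \<equiv> \<lambda>x. h x + M * \<psi> x + c * x"
    have "1-lipschitz_on {a..b} \<psi>"
    proof (rule lipschitz_onI)
      fix x y assume "x \<in> {a..b}" "y \<in> {a..b}"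
      then show "dist (\<psi> x) (\<psi> y) \<le> 1 * dist x y"
        using \<psi>_mono[of x y] \<psi>_mono[of y x] \<psi>_diff_le[of x y] \<psi>_diff_le[of y x]
        by (cases "x \<le> y") (auto simp: dist_real_def)
    qed simp
    then have "continuous_on {a..b} k"
      unfolding k_def using lip by (intro continuous_intros lipschitz_on_continuous_on)
    then have "k a \<le> k b"
    proof (rule le_if_locally_nondecreasing[OF \<open>a \<le> b\<close>])
      fix x assume x: "x \<in> {a..<b}"
      show "\<exists>v\<in>{x<..b}. k x \<le> k v"
      proof (cases "x \<in> N")
        case False
        then obtain v where v: "v \<in> {x<..b}" "- c * (v - x) \<le> h v - h x"
          using incr x \<open>c > 0\<close> by blast
        have "M * \<psi> x \<le> M * \<psi> v"
          using \<psi>_mono[of x v] x v \<open>M \<ge> 0\<close> by (intro mult_left_mono) auto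
        then have "k x \<le> k v"
          using v(2) by (simp add: k_def algebra_simps)
        with v show ?thesis
          by blast
      next
        case True
        \<comment> \<open>Openness of \<open>T\<close> puts a whole interval to the right of
          \<open>x\<close> inside \<open>T\<close>, where \<open>\<psi>\<close> has slope exactly 1.
          Then \<open>M * \<psi>\<close> offsets the fastest decrease that the Lipschitz constant
          allows.\<close>
        then obtain d where "d > 0" and d: "ball x d \<subseteq> T"
          using T by (meson open_contains_ball subsetD)
        define v where "v = min b (x + d / 2)"
        have v: "x < v" "v \<le> b" "v < x + d"
          using x \<open>d > 0\<close> by (auto simp: v_def)
        then have "{x<..v} \<subseteq> T"
          using d by (auto simp: subset_iff dist_real_def)
        then have "\<psi> v - \<psi> x = v - x"
          using \<psi>_diff[of x v] x v by (simp add: Int_absorb1)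
        then have \<psi>v: "M * \<psi> v - M * \<psi> x = M * (v - x)"
          by (metis right_diff_distrib)
        have "dist (h v) (h x) \<le> M * dist v x"
          using lip x v by (intro lipschitz_onD) auto
        then have "- (M * (v - x)) \<le> h v - h x"
          using v by (simp add: dist_real_def abs_if split: if_splits)
        moreover have "c * x \<le> c * v"
          using v \<open>c > 0\<close> by simp
        ultimately have "k x \<le> k v"
          using \<psi>v unfolding k_def by linarith
        with v show ?thesis
          by auto
      qed
    qed
    moreover have "\<psi> b \<le> c"
    proof -
      have "(T - N) \<union> N \<in> lmeasurable"
        by (intro fmeasurable.Un T(3) negligible_imp_measurable N)
      then have "\<psi> b \<le> measure lebesgue ((T - N) \<union> N)"
        unfolding \<psi>_def by (rule measure_mono_fmeasurable[rotated 2]) (use meas(1) in \<open>auto intro: fmeasurableD\<close>)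
      also have "\<dots> \<le> measure lebesgue (T - N) + measure lebesgue N"
        using T(3) N by (intro measure_Un_le) (auto intro!: fmeasurableD negligible_imp_sets)
      also have "\<dots> \<le> c"
        using T(3,4) N \<open>c > 0\<close> by (simp add: negligible_imp_measure0 emeasure_eq_measure2 ennreal_less_iff)
      finally show ?thesis .
    qed
    moreover have "\<psi> a \<ge> 0"
      by (simp add: \<psi>_def)
    ultimately have "M * \<psi> b \<le> c * M" "0 \<le> M * \<psi> a"
      using \<open>M \<ge> 0\<close> by (simp_all add: mult.commute mult_left_mono)
    moreover have "c * (M + b - a) = c * M + c * b - c * a"
      by (simp add: algebra_simps)
    ultimately show ?thesis
      using \<open>k a \<le> k b\<close> unfolding k_def by linarith
  qed
  show ?thesis
  proof (rule field_le_epsilon)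
    fix e :: real assume "e > 0"
    \<comment> \<open>The summand 1 keeps the divisor positive when \<open>M = 0\<close> and
      \<open>a = b\<close>.\<close>
    define K where "K = M + b - a + 1"
    have "K > 0"
      using \<open>M \<ge> 0\<close> \<open>a \<le> b\<close> by (simp add: K_def)
    have "h a \<le> h b + (e / K) * (M + b - a)"
      using \<open>e > 0\<close> \<open>K > 0\<close> by (intro main) simp
    also have "(e / K) * (M + b - a) \<le> (e / K) * K"
      using \<open>e > 0\<close> \<open>K > 0\<close> by (intro mult_left_mono) (auto simp: K_def)
    finally show "h a \<le> h b + e"
      using \<open>K > 0\<close> by simp
  qed
qed

text \<open>Almost everywhere the indefinite integral \<open>G\<close> has derivative
  \<open>g\<close>, so \<open>f - G\<close> has a nonnegative upper right derivate there and
  \<open>le_if_right_derivate_nonneg_ae\<close> applies. That lemma asks for one later point only,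
  so quotients at the steps 1/(n+1) suffice.\<close>

lemma integral_le_if_right_derivate_ge:
  fixes f g :: "real \<Rightarrow> real"
  assumes "a \<le> b" and lip: "M-lipschitz_on {a..b} f"
    and g: "g integrable_on {a..b}" "\<And>x. x \<in> {a..b} \<Longrightarrow> \<bar>g x\<bar> \<le> B"
    and der: "\<And>x c. x \<in> {a..<b} \<Longrightarrow> c < g x \<Longrightarrow>
      \<exists>\<^sub>F n in sequentially. c < real (Suc n) * (f (x + 1 / real (Suc n)) - f x)"
  shows "integral {a..b} g \<le> f b - f a"
proof -
  define G where "G \<equiv> \<lambda>t. integral {a..t} g"
  \<comment> \<open>The differentiability result concerns the open interval only, so the end point
    \<open>a\<close> joins the exceptional set.\<close>
  define N where "N = insert a {x\<in>{a<..<b}. \<not> (G has_vector_derivative g x) (at x)}"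
  have "B \<ge> 0"
    using g(2)[of a] \<open>a \<le> b\<close> by force
  have G_le: "\<bar>G y - G x\<bar> \<le> B * (y - x)" if "a \<le> x" "x \<le> y" "y \<le> b" for x y
  proof -
    have int: "g integrable_on {a..y}" "g integrable_on {x..y}"
      using g(1) that by (auto intro: integrable_subinterval_real)
    have "G y - G x = integral {x..y} g"
      using Henstock_Kurzweil_Integration.integral_combine[of a x y g] int that by (simp add: G_def algebra_simps)
    moreover have "norm (integral {x..y} g) \<le> integral {x..y} (\<lambda>_. B)"
      using int g(2) that by (intro integral_norm_bound_integral) auto
    ultimately show ?thesis
      using that by (simp add: mult.commute)
  qed
  have "B-lipschitz_on {a..b} G"
  proof (rule lipschitz_onI)
    fix x y assume "x \<in> {a..b}" "y \<in> {a..b}"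
    then show "dist (G x) (G y) \<le> B * dist x y"
      using G_le[of x y] G_le[of y x] by (cases "x \<le> y") (auto simp: dist_real_def)
  qed fact
  with lip have "(M + B)-lipschitz_on {a..b} (\<lambda>x. f x - G x)"
    by (rule lipschitz_on_diff)
  moreover have "negligible N"
    using negligible_integral_not_differentiable[OF g(1)] by (simp add: N_def G_def[abs_def])
  ultimately have "f a - G a \<le> f b - G b"
  proof (rule le_if_right_derivate_nonneg_ae[OF \<open>a \<le> b\<close>])
    fix x c :: real assume x: "x \<in> {a..<b}" "x \<notin> N" and "c > 0"
    then have "(G has_vector_derivative g x) (at x)"
      by (auto simp: N_def)
    \<comment> \<open>Half of \<open>c\<close> is spent on the linearization error of
      \<open>G\<close>, the other half on the quotient of \<open>f\<close>.\<close>
    then obtain d where "d > 0" and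
      d: "\<And>y. \<bar>y - x\<bar> < d \<Longrightarrow> \<bar>G y - G x - (y - x) * g x\<bar> \<le> c / 2 * \<bar>y - x\<bar>"
      using \<open>c > 0\<close> half_gt_zero[OF \<open>c > 0\<close>] unfolding has_vector_derivative_def has_derivative_at_alt
      by (metis real_norm_def real_scaleR_def)
    have "(\<lambda>n. 1 / real (Suc n)) \<longlonglongrightarrow> 0"
      using LIMSEQ_inverse_real_of_nat by (simp add: inverse_eq_divide)
    moreover have "min d (b - x) > 0"
      using \<open>d > 0\<close> x by simp
    ultimately have "\<forall>\<^sub>F n in sequentially. 1 / real (Suc n) < min d (b - x)"
      by (rule order_tendstoD)
    then obtain n where n: "1 / real (Suc n) < min d (b - x)"
      "g x - c / 2 < real (Suc n) * (f (x + 1 / real (Suc n)) - f x)"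
    proof -
      have "\<exists>\<^sub>F n in sequentially. g x - c / 2 < real (Suc n) * (f (x + 1 / real (Suc n)) - f x)"
        using der x \<open>c > 0\<close> by simp
      moreover have "\<forall>\<^sub>F n in sequentially.
          g x - c / 2 < real (Suc n) * (f (x + 1 / real (Suc n)) - f x) \<longrightarrow>
          1 / real (Suc n) < min d (b - x) \<and> g x - c / 2 < real (Suc n) * (f (x + 1 / real (Suc n)) - f x)"
        using \<open>\<forall>\<^sub>F n in sequentially. 1 / real (Suc n) < min d (b - x)\<close> by (rule eventually_mono) simp
      ultimately have "\<exists>\<^sub>F n in sequentially. 1 / real (Suc n) < min d (b - x) \<and>
          g x - c / 2 < real (Suc n) * (f (x + 1 / real (Suc n)) - f x)"
        by (rule frequently_rev_mp)
      then show ?thesis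
        using that by (auto dest: frequently_ex)
    qed
    define v where "v = x + 1 / real (Suc n)"
    have v: "x < v" "v < x + d" "v \<le> b" and vx: "real (Suc n) = 1 / (v - x)"
      using n by (auto simp: v_def field_simps)
    have "(g x - c / 2) * (v - x) < f v - f x"
      using n(2) v unfolding vx v_def[symmetric] by (simp add: field_simps)
    moreover have "G v - G x \<le> (v - x) * g x + c / 2 * (v - x)"
      using d[of v] v by (simp add: abs_if split: if_splits)
    moreover have "(g x - c / 2) * (v - x) = (v - x) * g x - c / 2 * (v - x)"
      "- c * (v - x) = - (c / 2 * (v - x)) - c / 2 * (v - x)"
      by (simp_all add: algebra_simps)
    ultimately have "- c * (v - x) \<le> f v - G v - (f x - G x)"
      by linarith
    with v show "\<exists>v\<in>{x<..b}. - c * (v - x) \<le> f v - G v - (f x - G x)"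
      by auto
  qed
  then show ?thesis
    by (simp add: G_def)
qed

section \<open>Lipschitz functions as integrals of their derivatives\<close>

lemma lipschitz_on_intervals_imp_isCont:
  fixes f :: "real \<Rightarrow> 'a::metric_space"
  assumes "\<And>a b. \<exists>M. M-lipschitz_on {a..b} f"
  shows "isCont f x"
proof -
  have "continuous_on {x - 1..x + 1} f"
    using assms lipschitz_on_continuous_on by blast
  then show ?thesis
    by (rule continuous_on_interior) simp
qed

text \<open>With \<open>g\<close> the upper and \<open>l\<close> the lower limit of the right
  quotients, the integral of \<open>g\<close> is at most the increment of \<open>f\<close>, which is
  at most the integral of \<open>l\<close>. Since \<open>l \<le> g\<close>, equality holds. So
  \<open>f\<close> is an indefinite integral of \<open>g\<close>, and
  \<open>negligible_integral_not_differentiable\<close> gives the derivative.\<close>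

lemma lipschitz_imp_integral_of_derivative_ae_real:
  fixes f :: "real \<Rightarrow> real"
  assumes lip: "\<And>a b. \<exists>M. M-lipschitz_on {a..b} f"
  obtains g where "g \<in> borel_measurable borel"
    and "\<And>a b. \<exists>B. \<forall>x\<in>{a..b}. \<bar>g x\<bar> \<le> B"
    and "\<And>a b. a \<le> b \<Longrightarrow> (g has_integral (f b - f a)) {a..b}"
    and "negligible {x. \<not> (f has_vector_derivative g x) (at x)}"
proof -
  \<comment> \<open>A sequence of step lengths keeps the upper and lower limits Borel
    measurable.\<close>
  define q where "q \<equiv> \<lambda>n x. real (Suc n) * (f (x + 1 / real (Suc n)) - f x)"
  define U where "U \<equiv> \<lambda>x. limsup (\<lambda>n. ereal (q n x))"
  define L where "L \<equiv> \<lambda>x. liminf (\<lambda>n. ereal (q n x))"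
  define g where "g \<equiv> \<lambda>x. real_of_ereal (U x)"
  define l where "l \<equiv> \<lambda>x. real_of_ereal (L x)"
  have "continuous_on UNIV f"
    using lipschitz_on_intervals_imp_isCont[OF lip] by (simp add: continuous_at_imp_continuous_on)
  then have [measurable]: "f \<in> borel_measurable borel"
    by (rule borel_measurable_continuous_onI)
  have [measurable]: "q n \<in> borel_measurable borel" for n
    unfolding q_def by measurable
  have [measurable]: "U \<in> borel_measurable borel" "L \<in> borel_measurable borel"
    unfolding U_def L_def by measurable
  have g_meas [measurable]: "g \<in> borel_measurable borel" and l_meas [measurable]: "l \<in> borel_measurable borel"
    unfolding g_def l_def by measurable
  have bound: "\<exists>B. \<forall>x\<in>{a..b}. \<bar>U x\<bar> \<le> ereal B \<and> \<bar>L x\<bar> \<le> ereal B" for a b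
  proof -
    \<comment> \<open>The steps reach at most 1 to the right, hence the interval up to
      \<open>b + 1\<close>.\<close>
    obtain M where M: "M-lipschitz_on {a..b + 1} f"
      using lip by blast
    have "\<bar>U x\<bar> \<le> ereal M \<and> \<bar>L x\<bar> \<le> ereal M" if x: "x \<in> {a..b}" for x
    proof -
      have q: "\<bar>q n x\<bar> \<le> M" for n
      proof -
        have "0 \<le> 1 / real (Suc n)" "1 / real (Suc n) \<le> 1"
          by simp_all
        then have "x + 1 / real (Suc n) \<in> {a..b + 1}" "x \<in> {a..b + 1}"
          using x unfolding atLeastAtMost_iff by linarith+
        then have "dist (f (x + 1 / real (Suc n))) (f x) \<le> M * dist (x + 1 / real (Suc n)) x"
          by (rule lipschitz_onD[OF M])
        then have "\<bar>f (x + 1 / real (Suc n)) - f x\<bar> \<le> M / real (Suc n)"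
          by (simp add: dist_real_def)
        then have "real (Suc n) * \<bar>f (x + 1 / real (Suc n)) - f x\<bar> \<le> M"
          by (simp only: pos_le_divide_eq of_nat_0_less_iff zero_less_Suc mult.commute)
        then show ?thesis
          by (simp only: q_def abs_mult abs_of_nat)
      qed
      have "U x \<le> M" "L x \<ge> - M" unfolding U_def L_def
        using q by (auto intro!: Limsup_bounded Liminf_bounded always_eventually simp: abs_le_iff minus_le_iff)
      moreover have "L x \<le> U x"
        unfolding U_def L_def by (rule Liminf_le_Limsup) simp
      ultimately show ?thesis
        by (cases "U x"; cases "L x") auto
    qed
    then show ?thesis
      by blast
  qed
  \<comment> \<open>\<open>real_of_ereal\<close> would send infinite values to 0; the Lipschitz
    bound excludes them, so \<open>g\<close> and \<open>l\<close> are the genuine limits.\<close>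
  have fin: "U x = ereal (g x)" "L x = ereal (l x)" for x
    using bound[of x x] by (cases "U x"; cases "L x"; auto simp: g_def l_def)+
  have bnd: "\<exists>B. \<forall>x\<in>{a..b}. \<bar>g x\<bar> \<le> B \<and> \<bar>l x\<bar> \<le> B" for a b
    using bound[of a b] by (simp add: fin)
  have "l x \<le> g x" for x
  proof -
    have "L x \<le> U x"
      unfolding U_def L_def by (rule Liminf_le_Limsup) simp
    then show ?thesis
      by (simp add: fin)
  qed
  have integrable: "h integrable_on {a..b}"
    if "h \<in> borel_measurable borel" "\<forall>x\<in>{a..b}. \<bar>h x\<bar> \<le> B" for h :: "real \<Rightarrow> real" and a b B
  proof (rule measurable_bounded_by_integrable_imp_integrable)
    have "h \<in> borel_measurable lebesgue"
      using that(1) by (intro measurable_completion) simp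
    then show "h \<in> borel_measurable (lebesgue_on {a..b})"
      by (rule measurable_restrict_space1)
    show "(\<lambda>_. B) integrable_on {a..b}"
      by (rule integrable_const_ivl)
  qed (use that(2) in auto)
  have int: "(g has_integral (f b - f a)) {a..b}" if "a \<le> b" for a b
  proof -
    obtain B where B: "\<forall>x\<in>{a..b}. \<bar>g x\<bar> \<le> B" "\<forall>x\<in>{a..b}. \<bar>l x\<bar> \<le> B"
      using bnd[of a b] by blast
    obtain M where M: "M-lipschitz_on {a..b} f"
      using lip by blast
    have gi: "g integrable_on {a..b}" and li: "l integrable_on {a..b}"
      using B by (auto intro: integrable)
    have "integral {a..b} g \<le> f b - f a"
    proof (rule integral_le_if_right_derivate_ge[OF \<open>a \<le> b\<close> M gi])
      fix x c assume "c < g x"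
      then have "\<not> U x \<le> ereal c"
        by (simp add: fin)
      then have "\<not> (\<forall>\<^sub>F n in sequentially. ereal (q n x) \<le> ereal c)"
        unfolding U_def by (rule contrapos_nn) (rule Limsup_bounded)
      then show "\<exists>\<^sub>F n in sequentially. c < real (Suc n) * (f (x + 1 / real (Suc n)) - f x)"
        by (simp add: q_def frequently_def not_less)
    qed (use B in auto)
    \<comment> \<open>The reverse estimate is the same argument for \<open>- f\<close>, whose
      quotients have upper limit \<open>- l\<close>.\<close>
    moreover have "integral {a..b} (\<lambda>x. - l x) \<le> - f b - - f a"
    proof (rule integral_le_if_right_derivate_ge[OF \<open>a \<le> b\<close>])
      show "M-lipschitz_on {a..b} (\<lambda>x. - f x)"
        using M by (simp add: lipschitz_on_minus)
      fix x c assume "c < - l x"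
      then have "\<not> ereal (- c) \<le> L x"
        by (simp add: fin)
      then have "\<not> (\<forall>\<^sub>F n in sequentially. ereal (- c) \<le> ereal (q n x))"
        unfolding L_def by (rule contrapos_nn) (rule Liminf_bounded)
      then have "\<exists>\<^sub>F n in sequentially. q n x < - c"
        by (simp add: frequently_def not_less)
      then show "\<exists>\<^sub>F n in sequentially. c < real (Suc n) * (- f (x + 1 / real (Suc n)) - - f x)"
        by (rule frequently_elim1) (simp add: q_def algebra_simps)
    qed (use B li in \<open>auto simp: integrable_neg\<close>)
    moreover have "integral {a..b} l \<le> integral {a..b} g"
      using li gi \<open>\<And>x. l x \<le> g x\<close> by (intro integral_le) auto
    ultimately have "integral {a..b} g = f b - f a"
      by simp
    with gi show ?thesis
      by (metis integrable_integral)
  qed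
  \<comment> \<open>The line is exhausted by the intervals from \<open>- n\<close> to
    \<open>n\<close>, on each of which \<open>f\<close> differs from an indefinite integral of
    \<open>g\<close> by a constant.\<close>
  have "negligible (\<Union>n. {x\<in>{- real n<..<real n}. \<not> ((\<lambda>t. integral {- real n..t} g) has_vector_derivative g x) (at x)})"
  proof (rule negligible_Union_nat)
    fix n :: nat
    show "negligible {x\<in>{- real n<..<real n}. \<not> ((\<lambda>t. integral {- real n..t} g) has_vector_derivative g x) (at x)}"
      using int[of "- real n" "real n"] by (intro negligible_integral_not_differentiable) auto
  qed
  then have "negligible {x. \<not> (f has_vector_derivative g x) (at x)}"
  proof (rule negligible_subset, intro subsetI)
    fix x assume x: "x \<in> {x. \<not> (f has_vector_derivative g x) (at x)}"
    obtain n where "\<bar>x\<bar> < real n"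
      using reals_Archimedean2 by blast
    then have n: "x \<in> {- real n<..<real n}"
      by auto
    have "\<not> ((\<lambda>t. integral {- real n..t} g) has_vector_derivative g x) (at x)"
    proof
      assume "((\<lambda>t. integral {- real n..t} g) has_vector_derivative g x) (at x)"
      then have 1: "((\<lambda>t. f (- real n) + integral {- real n..t} g) has_vector_derivative g x) (at x)"
        by (auto intro!: derivative_eq_intros)
      have 2: "f (- real n) + integral {- real n..y} g = f y" if "y \<in> {- real n<..<real n}" for y
        using int[of "- real n" y, THEN integral_unique] that by simp
      have "(f has_vector_derivative g x) (at x)"
        using has_vector_derivative_transform_within_open[OF 1 open_greaterThanLessThan n 2] .
      with x show False
        by simp
    qed
    with n show "x \<in> (\<Union>n. {x\<in>{- real n<..<real n}. \<not> ((\<lambda>t. integral {- real n..t} g) has_vector_derivative g x) (at x)})"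
      by blast
  qed
  with g_meas int bnd show ?thesis
    by (intro that[of g]) blast+
qed

text \<open>Each coordinate inherits the Lipschitz bound; the exceptional set is a finite union of
  null sets, one per basis vector.\<close>

lemma lipschitz_imp_integral_of_derivative_ae:
  fixes f :: "real \<Rightarrow> 'a::euclidean_space"
  assumes lip: "\<And>a b. \<exists>M. M-lipschitz_on {a..b} f"
  obtains g where "g \<in> borel_measurable borel"
    and "\<And>a b. \<exists>B. \<forall>x\<in>{a..b}. norm (g x) \<le> B"
    and "\<And>a b. a \<le> b \<Longrightarrow> (g has_integral (f b - f a)) {a..b}"
    and "negligible {x. \<not> (f has_vector_derivative g x) (at x)}"
proof -
  have "\<exists>g. g \<in> borel_measurable borel \<and> (\<forall>a b. \<exists>B. \<forall>x\<in>{a..b}. \<bar>g x\<bar> \<le> B) \<and>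
      (\<forall>a b. a \<le> b \<longrightarrow> (g has_integral (f b \<bullet> i - f a \<bullet> i)) {a..b}) \<and>
      negligible {x. \<not> ((\<lambda>x. f x \<bullet> i) has_vector_derivative g x) (at x)}" if "i \<in> Basis" for i
  proof -
    have "\<exists>M. M-lipschitz_on {a..b} (\<lambda>x. f x \<bullet> i)" for a b
    proof -
      obtain M where M: "M-lipschitz_on {a..b} f"
        using lip by blast
      have "M-lipschitz_on {a..b} (\<lambda>x. f x \<bullet> i)"
      proof (rule lipschitz_onI)
        fix x y assume "x \<in> {a..b}" "y \<in> {a..b}"
        then have "norm (f x - f y) \<le> M * dist x y"
          using lipschitz_onD[OF M] by (simp add: dist_norm)
        then show "dist (f x \<bullet> i) (f y \<bullet> i) \<le> M * dist x y"
          using Basis_le_norm[OF that, of "f x - f y"] by (simp add: dist_real_def inner_diff_left)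
      qed (use M lipschitz_on_nonneg in blast)
      then show ?thesis
        by blast
    qed
    note lip_i = this
    show ?thesis
    proof (rule lipschitz_imp_integral_of_derivative_ae_real[OF lip_i])
      fix g :: "real \<Rightarrow> real"
      assume g: "g \<in> borel_measurable borel" "\<And>a b. \<exists>B. \<forall>x\<in>{a..b}. \<bar>g x\<bar> \<le> B"
        "\<And>a b. a \<le> b \<Longrightarrow> (g has_integral (f b \<bullet> i - f a \<bullet> i)) {a..b}"
        "negligible {x. \<not> ((\<lambda>x. f x \<bullet> i) has_vector_derivative g x) (at x)}"
      show ?thesis
        by (intro exI[of _ g] conjI allI impI g)
    qed
  qed
  then have "\<forall>i\<in>Basis. \<exists>g. g \<in> borel_measurable borel \<and> (\<forall>a b. \<exists>B. \<forall>x\<in>{a..b}. \<bar>g x\<bar> \<le> B) \<and>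
      (\<forall>a b. a \<le> b \<longrightarrow> (g has_integral (f b \<bullet> i - f a \<bullet> i)) {a..b}) \<and>
      negligible {x. \<not> ((\<lambda>x. f x \<bullet> i) has_vector_derivative g x) (at x)}"
    by blast
  from bchoice[OF this] obtain g where g [measurable]: "\<And>i. i \<in> Basis \<Longrightarrow> g i \<in> borel_measurable borel"
    and bnd: "\<And>i a b. i \<in> Basis \<Longrightarrow> \<exists>B. \<forall>x\<in>{a..b}. \<bar>g i x\<bar> \<le> B"
    and int: "\<And>i a b. i \<in> Basis \<Longrightarrow> a \<le> b \<Longrightarrow> (g i has_integral (f b \<bullet> i - f a \<bullet> i)) {a..b}"
    and der: "\<And>i. i \<in> Basis \<Longrightarrow> negligible {x. \<not> ((\<lambda>x. f x \<bullet> i) has_vector_derivative g i x) (at x)}"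
    by blast
  define h where "h \<equiv> \<lambda>x. \<Sum>i\<in>Basis. g i x *\<^sub>R i"
  have h_inner: "h x \<bullet> i = g i x" if "i \<in> Basis" for x i
    using that by (simp add: h_def inner_sum_left_Basis)
  show thesis
  proof (rule that[of h])
    show "h \<in> borel_measurable borel"
      unfolding h_def by measurable
    show "\<exists>B. \<forall>x\<in>{a..b}. norm (h x) \<le> B" for a b
    proof -
      obtain B where B: "\<forall>i\<in>Basis. \<forall>x\<in>{a..b}. \<bar>g i x\<bar> \<le> B i"
        using bchoice[of Basis "\<lambda>i B. \<forall>x\<in>{a..b}. \<bar>g i x\<bar> \<le> B"] bnd by blast
      have "norm (h x) \<le> (\<Sum>i\<in>Basis. B i)" if "x \<in> {a..b}" for x
        using norm_le_l1[of "h x"] sum_mono[of Basis "\<lambda>i. \<bar>h x \<bullet> i\<bar>" B] B that h_inner by fastforce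
      then show ?thesis
        by blast
    qed
    show "(h has_integral (f b - f a)) {a..b}" if "a \<le> b" for a b
      using int[OF _ that] by (subst has_integral_componentwise_iff) (simp add: h_inner inner_diff_left)
    have "{x. \<not> (f has_vector_derivative h x) (at x)} \<subseteq>
        (\<Union>i\<in>Basis. {x. \<not> ((\<lambda>x. f x \<bullet> i) has_vector_derivative g i x) (at x)})"
      unfolding has_vector_derivative_def
      by (subst has_derivative_componentwise_within) (auto simp: h_inner)
    then show "negligible {x. \<not> (f has_vector_derivative h x) (at x)}"
      by (rule negligible_subset[rotated]) (auto intro: der)
  qed
qed

subsection \<open>Differential inclusions of linear growth\<close>

primrec euler :: "(real \<Rightarrow> 'a \<Rightarrow> 'a) \<Rightarrow> real \<Rightarrow> 'a \<Rightarrow> real \<Rightarrow> nat \<Rightarrow> 'a::real_vector" where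
  "euler F t0 z0 h 0 = z0"
| "euler F t0 z0 h (Suc k) = euler F t0 z0 h k + h *\<^sub>R F (t0 + real k * h) (euler F t0 z0 h k)"

lemma euler_diff:
  assumes "j \<le> k"
  shows "euler F t0 z0 h k - euler F t0 z0 h j =
    h *\<^sub>R (\<Sum>i\<in>{j..<k}. F (t0 + real i * h) (euler F t0 z0 h i))"
  using assms by (induction k rule: dec_induct) (simp_all add: scaleR_add_right algebra_simps)

locale linear_growth =
  fixes F :: "real \<Rightarrow> 'a::euclidean_space \<Rightarrow> 'a" and t0 :: real and c :: "real \<Rightarrow> real" and z0 :: 'a
  assumes growth: "\<And>t z. t0 \<le> t \<Longrightarrow> norm (F t z) \<le> c t * (1 + norm z)"
    and c_mono: "\<And>s t. t0 \<le> s \<Longrightarrow> s \<le> t \<Longrightarrow> c s \<le> c t"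
begin

lemma c_nonneg: "t0 \<le> t \<Longrightarrow> 0 \<le> c t"
  using order_trans[OF norm_ge_zero growth[of t 0]] by simp

text \<open>The Gronwall bound for \<open>1 + norm\<close> at time \<open>T\<close>, with the rate
  frozen at its largest value \<open>c T\<close>.\<close>

definition radius :: "real \<Rightarrow> real" where
  "radius T = (1 + norm z0) * exp (c T * (T - t0))"

definition speed :: "real \<Rightarrow> real" where
  "speed T = c T * radius T"

lemma speed_nonneg: "t0 \<le> T \<Longrightarrow> 0 \<le> speed T"
  using c_nonneg by (simp add: speed_def radius_def)

text \<open>Discrete Gronwall: one step multiplies \<open>1 + norm\<close> by at most
  \<open>1 + c T * h\<close>, which is at most \<open>exp (c T * h)\<close>.\<close>

lemma euler_bound:
  assumes "0 \<le> h" "t0 + real k * h \<le> T"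
  shows "1 + norm (euler F t0 z0 h k) \<le> radius T"
proof -
  have "1 + norm (euler F t0 z0 h k) \<le> (1 + norm z0) * exp (c T * (real k * h))"
    using assms(2)
  proof (induction k)
    case 0
    then show ?case by simp
  next
    case (Suc k)
    let ?y = "euler F t0 z0 h k" and ?t = "t0 + real k * h"
    have t: "t0 \<le> ?t" "?t \<le> T"
      using Suc.prems \<open>0 \<le> h\<close> by (auto simp: distrib_right)
    have "norm (F ?t ?y) \<le> c T * (1 + norm ?y)"
      using growth[OF t(1), of ?y] mult_right_mono[OF c_mono[OF t], of "1 + norm ?y"] by simp
    then have "norm (h *\<^sub>R F ?t ?y) \<le> h * (c T * (1 + norm ?y))"
      using \<open>0 \<le> h\<close> by (simp add: mult_left_mono)
    then have "1 + norm (euler F t0 z0 h (Suc k)) \<le> (1 + norm ?y) * (1 + c T * h)"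
      using norm_triangle_ineq[of ?y "h *\<^sub>R F ?t ?y"] by (simp add: algebra_simps)
    also have "\<dots> \<le> ((1 + norm z0) * exp (c T * (real k * h))) * exp (c T * h)"
      using Suc.IH t exp_ge_add_one_self[of "c T * h"] c_nonneg[OF order_trans[OF t]] \<open>0 \<le> h\<close>
      by (intro mult_mono add_nonneg_nonneg mult_nonneg_nonneg) auto
    also have "\<dots> = (1 + norm z0) * exp (c T * (real (Suc k) * h))"
      by (simp add: algebra_simps flip: exp_add)
    finally show ?case .
  qed
  also have "\<dots> \<le> radius T"
  proof -
    have "t0 \<le> T"
      using assms mult_nonneg_nonneg[of "real k" h] by linarith
    then show ?thesis
      unfolding radius_def using assms c_nonneg by (intro mult_left_mono) (auto intro!: mult_left_mono)
  qed
  finally show ?thesis .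
qed

lemma F_euler_bound:
  assumes "0 \<le> h" "t0 + real k * h \<le> T"
  shows "norm (F (t0 + real k * h) (euler F t0 z0 h k)) \<le> speed T"
proof -
  have t: "t0 \<le> t0 + real k * h"
    using assms by simp
  have "norm (F (t0 + real k * h) (euler F t0 z0 h k)) \<le> c (t0 + real k * h) * (1 + norm (euler F t0 z0 h k))"
    by (rule growth[OF t])
  also have "\<dots> \<le> c T * radius T"
    using c_mono[OF t assms(2)] c_nonneg[OF t] c_nonneg[of T] t assms euler_bound[OF assms] by (intro mult_mono) auto
  finally show ?thesis
    by (simp add: speed_def)
qed

lemma euler_lipschitz:
  assumes "0 \<le> h" "j \<le> k" "t0 + real k * h \<le> T"
  shows "norm (euler F t0 z0 h k - euler F t0 z0 h j) \<le> speed T * (real k * h - real j * h)"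
proof -
  have "norm (\<Sum>i\<in>{j..<k}. F (t0 + real i * h) (euler F t0 z0 h i)) \<le> (\<Sum>i\<in>{j..<k}. speed T)"
  proof (intro sum_norm_le F_euler_bound)
    fix i assume "i \<in> {j..<k}"
    then have "real i * h \<le> real k * h"
      using \<open>0 \<le> h\<close> by (intro mult_right_mono) auto
    then show "t0 + real i * h \<le> T"
      using assms(3) by simp
  qed (use \<open>0 \<le> h\<close> in auto)
  then have "h * norm (\<Sum>i\<in>{j..<k}. F (t0 + real i * h) (euler F t0 z0 h i)) \<le> h * (real (k - j) * speed T)"
    using \<open>0 \<le> h\<close> by (intro mult_left_mono) simp_all
  then show ?thesis
    using assms by (simp add: euler_diff of_nat_diff algebra_simps)
qed

text \<open>Between two grid times the quotient is exactly the arithmetic mean of the values of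
  \<open>F\<close> used there, so convexity of \<open>D\<close> suffices.\<close>

lemma euler_difference_quotient_mem:
  assumes "0 < h" "j < k" "convex D"
    and D: "\<And>i. j \<le> i \<Longrightarrow> i < k \<Longrightarrow> F (t0 + real i * h) (euler F t0 z0 h i) \<in> D"
  shows "(euler F t0 z0 h k - euler F t0 z0 h j) /\<^sub>R (real k * h - real j * h) \<in> D"
proof -
  have "(\<Sum>i\<in>{j..<k}. (1 / real (k - j)) *\<^sub>R F (t0 + real i * h) (euler F t0 z0 h i)) \<in> D"
    using assms by (intro convex_sum) (auto intro: D)
  moreover have "inverse (real k * h - real j * h) * h = 1 / real (k - j)"
    using assms by (simp add: of_nat_diff field_simps flip: left_diff_distrib)
  ultimately show ?thesis
    using assms by (simp add: euler_diff scaleR_sum_right)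
qed

section \<open>Euler curves and their cluster points\<close>

definition step :: "nat \<Rightarrow> real" where
  "step n = 1 / real (Suc n)"

text \<open>The index of the last grid time not after \<open>t\<close>; \<open>nat\<close> sends all
  times before \<open>t0\<close> to index 0.\<close>

definition node :: "nat \<Rightarrow> real \<Rightarrow> nat" where
  "node n t = nat \<lfloor>(t - t0) / step n\<rfloor>"

text \<open>Piecewise constant instead of affine: every value is an actual Euler iterate, and the
  jumps disappear in the limit.\<close>

definition approx_sol :: "nat \<Rightarrow> real \<Rightarrow> 'a" where
  "approx_sol n t = euler F t0 z0 (step n) (node n t)"

lemma step_pos: "0 < step n"
  by (simp add: step_def)

lemma step_tendsto_0: "step \<longlonglongrightarrow> 0"
  using LIMSEQ_inverse_real_of_nat unfolding step_def[abs_def] by (simp add: inverse_eq_divide)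

lemma node_bounds:
  assumes "t0 \<le> t"
  shows "t0 + real (node n t) * step n \<le> t" "t < t0 + real (node n t) * step n + step n"
proof -
  have "0 \<le> (t - t0) / step n"
    using assms step_pos[of n] by simp
  then have "real (node n t) = of_int \<lfloor>(t - t0) / step n\<rfloor>"
    by (simp add: node_def)
  then have "real (node n t) \<le> (t - t0) / step n" "(t - t0) / step n < real (node n t) + 1"
    by linarith+
  then show "t0 + real (node n t) * step n \<le> t" "t < t0 + real (node n t) * step n + step n"
    using step_pos[of n] by (simp_all add: field_simps)
qed

lemma node_mono: "s \<le> t \<Longrightarrow> node n s \<le> node n t"
  using step_pos[of n] by (auto simp: node_def intro!: nat_mono floor_mono divide_right_mono)

text \<open>With \<open>max t t0\<close> the bound is available at every real time, so all curves
  lie in one product of balls indexed by the whole line.\<close>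

lemma approx_sol_bound: "norm (approx_sol n t) \<le> radius (max t t0)"
proof (cases "t0 \<le> t")
  case True
  then show ?thesis
    using euler_bound[of "step n" "node n t" t] node_bounds[of t n] step_pos[of n] by (simp add: approx_sol_def max_def)
next
  case False
  then have "(t - t0) / step n \<le> 0"
    using step_pos[of n] by (simp add: divide_nonpos_pos)
  then have "\<lfloor>(t - t0) / step n\<rfloor> \<le> 0"
    using floor_mono by fastforce
  then have "node n t = 0"
    by (simp add: node_def)
  then show ?thesis
    using False by (simp add: approx_sol_def radius_def max_def)
qed

text \<open>Rounding both times down to the grid can lengthen their distance by at most one step,
  which is the extra term.\<close>

lemma approx_sol_lipschitz:
  assumes "t0 \<le> s" "s \<le> t" "t \<le> T"
  shows "norm (approx_sol n t - approx_sol n s) \<le> speed T * (t - s + step n)"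
proof -
  have "norm (approx_sol n t - approx_sol n s) \<le> speed T * (real (node n t) * step n - real (node n s) * step n)"
    unfolding approx_sol_def using assms node_bounds[of t n] step_pos[of n] node_mono by (intro euler_lipschitz) auto
  also have "\<dots> \<le> speed T * (t - s + step n)"
    using node_bounds[of t n] node_bounds[of s n] assms speed_nonneg[of T] by (intro mult_left_mono) auto
  finally show ?thesis .
qed

text \<open>Passing to a finer filter \<open>G\<close> instead of a subsequence gives pointwise convergence at
  every time at once, by Tychonoff, with no diagonal argument.\<close>

lemma cluster_filter:
  obtains G z where "G \<noteq> bot" "G \<le> sequentially" "\<forall>t. ((\<lambda>n. approx_sol n t) \<longlongrightarrow> z t) G"
proof -
  define K where "K = Pi\<^sub>E UNIV (\<lambda>t. cball (0::'a) (radius (max t t0)))"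
  have "compact K"
    unfolding K_def compactin_euclidean_iff[symmetric] euclidean_product_topology[symmetric]
    by (simp add: compactin_PiE)
  moreover have "filtermap approx_sol sequentially \<noteq> bot"
    by (simp add: filtermap_bot_iff)
  moreover have "\<forall>\<^sub>F x in filtermap approx_sol sequentially. x \<in> K"
    using approx_sol_bound by (auto simp: eventually_filtermap K_def PiE_iff intro!: always_eventually)
  ultimately obtain z where z: "inf (nhds z) (filtermap approx_sol sequentially) \<noteq> bot"
    unfolding compact_filter by blast
  \<comment> \<open>\<open>G\<close> refines \<open>sequentially\<close> by requiring
    \<open>approx_sol n\<close> to be close to \<open>z\<close>; it is proper because
    \<open>z\<close> is a cluster point.\<close>
  define G where "G = inf sequentially (filtercomap approx_sol (nhds z))"
  have "G \<noteq> bot"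
  proof
    assume "G = bot"
    then have "eventually (\<lambda>_. False) G"
      by simp
    then obtain P Q where "eventually P sequentially" "eventually Q (nhds z)" "\<And>n. P n \<Longrightarrow> \<not> Q (approx_sol n)"
      unfolding G_def eventually_inf eventually_filtercomap by blast
    then have "eventually (\<lambda>_. False) (inf (nhds z) (filtermap approx_sol sequentially))"
      unfolding eventually_inf eventually_filtermap
      by (intro exI[of _ Q] exI[of _ "\<lambda>y. \<not> Q y"]) (auto elim: eventually_mono)
    with z show False
      by (simp add: eventually_False)
  qed
  moreover have "G \<le> sequentially"
    by (simp add: G_def)
  moreover have "((\<lambda>n. approx_sol n t) \<longlongrightarrow> z t) G" for t
  proof -
    have "filterlim approx_sol (nhds z) G"
      unfolding G_def by (meson filterlim_filtercomap filterlim_mono inf_le2 order_refl)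
    show ?thesis
    proof (rule topological_tendstoI)
      fix S :: "'a set" assume "open S" "z t \<in> S"
      moreover have "open ((\<lambda>x. x t) -` S)"
        using \<open>open S\<close> by (intro open_vimage continuous_on_product_coordinates)
      ultimately show "\<forall>\<^sub>F n in G. approx_sol n t \<in> S"
        using topological_tendstoD[OF \<open>(approx_sol \<longlongrightarrow> z) G\<close>, of "(\<lambda>x. x t) -` S"] by simp
    qed
  qed
  ultimately show thesis
    using that by blast
qed

end

text \<open>No regularity of \<open>F\<close> is assumed; the last conclusion is how the values of \<open>F\<close> near
  \<open>(t, z t)\<close> control the velocity at \<open>t\<close>.\<close>

theorem krasovskii_solution_exists:
  fixes F :: "real \<Rightarrow> 'a::euclidean_space \<Rightarrow> 'a"
  assumes growth: "\<And>t z. t0 \<le> t \<Longrightarrow> norm (F t z) \<le> c t * (1 + norm z)"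
    and c_mono: "\<And>s t. t0 \<le> s \<Longrightarrow> s \<le> t \<Longrightarrow> c s \<le> c t"
  obtains z where "z t0 = z0" "\<forall>T. \<exists>M. M-lipschitz_on {t0..T} z"
    "\<forall>t D. t0 \<le> t \<longrightarrow> closed D \<longrightarrow> convex D \<longrightarrow>
      (\<exists>d>0. \<forall>r\<ge>t0. \<forall>y. \<bar>r - t\<bar> < d \<longrightarrow> dist y (z t) < d \<longrightarrow> F r y \<in> D) \<longrightarrow>
      (\<exists>\<delta>>0. \<forall>s\<ge>t0. \<forall>s'>s. \<bar>s - t\<bar> < \<delta> \<longrightarrow> \<bar>s' - t\<bar> < \<delta> \<longrightarrow> (z s' - z s) /\<^sub>R (s' - s) \<in> D)"
proof -
  interpret linear_growth F t0 c z0
    by standard (fact growth c_mono)+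
  obtain G z where G: "G \<noteq> bot" "G \<le> sequentially" and lim': "\<forall>t. ((\<lambda>n. approx_sol n t) \<longlongrightarrow> z t) G"
    by (rule cluster_filter)
  note lim = lim'[rule_format]
  have step_lim: "(step \<longlongrightarrow> 0) G"
    using step_tendsto_0 G(2) by (rule tendsto_mono[rotated])
  show thesis
  proof (rule that[of z])
    have "((\<lambda>n. approx_sol n t0) \<longlongrightarrow> z0) G"
      by (simp add: approx_sol_def node_def)
    then show "z t0 = z0"
      using lim tendsto_unique[OF G(1)] by blast
  next
    show "\<forall>T. \<exists>M. M-lipschitz_on {t0..T} z"
    proof
      fix T
      show "\<exists>M. M-lipschitz_on {t0..T} z"
      proof (cases "t0 \<le> T")
        case True
        \<comment> \<open>The extra \<open>step n\<close> in \<open>approx_sol_lipschitz\<close>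
          tends to 0 along \<open>G\<close>, which leaves a true Lipschitz bound.\<close>
        have *: "dist (z s) (z t) \<le> speed T * dist s t" if "t0 \<le> s" "s \<le> t" "t \<le> T" for s t
        proof -
          have 1: "((\<lambda>n. norm (approx_sol n t - approx_sol n s)) \<longlongrightarrow> norm (z t - z s)) G"
            by (intro tendsto_intros lim)
          have 2: "((\<lambda>n. speed T * (t - s + step n)) \<longlongrightarrow> speed T * (t - s + 0)) G"
            by (intro tendsto_intros step_lim)
          have "norm (z t - z s) \<le> speed T * (t - s + 0)"
            by (rule tendsto_le[OF G(1) 2 1]) (use approx_sol_lipschitz that in simp)
          then show ?thesis
            using that by (simp add: dist_norm norm_minus_commute)
        qed
        have "(speed T)-lipschitz_on {t0..T} z"
        proof (rule lipschitz_onI)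
          fix s t assume "s \<in> {t0..T}" "t \<in> {t0..T}"
          then show "dist (z s) (z t) \<le> speed T * dist s t"
            using *[of s t] *[of t s] by (cases "s \<le> t") (auto simp: dist_commute)
        qed (use True speed_nonneg in blast)
        then show ?thesis
          by blast
      qed (auto intro: lipschitz_on_subset)
    qed
  next
    show "\<forall>t D. t0 \<le> t \<longrightarrow> closed D \<longrightarrow> convex D \<longrightarrow>
      (\<exists>d>0. \<forall>r\<ge>t0. \<forall>y. \<bar>r - t\<bar> < d \<longrightarrow> dist y (z t) < d \<longrightarrow> F r y \<in> D) \<longrightarrow>
      (\<exists>\<delta>>0. \<forall>s\<ge>t0. \<forall>s'>s. \<bar>s - t\<bar> < \<delta> \<longrightarrow> \<bar>s' - t\<bar> < \<delta> \<longrightarrow> (z s' - z s) /\<^sub>R (s' - s) \<in> D)"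
    proof (intro allI impI, elim exE conjE)
      fix t D and d :: real
      assume t: "t0 \<le> t" and D: "closed D" "convex D" and "d > 0"
        and near: "\<forall>r\<ge>t0. \<forall>y. \<bar>r - t\<bar> < d \<longrightarrow> dist y (z t) < d \<longrightarrow> F r y \<in> D"
      define m where "m = speed (t + d)"
      have "m \<ge> 0"
        using speed_nonneg[of "t + d"] t \<open>d > 0\<close> by (simp add: m_def)
      \<comment> \<open>Chosen to make both \<open>8 * \<delta>\<close> and
        \<open>8 * (m * \<delta>)\<close> at most \<open>d\<close>; the summand 1 covers
        \<open>m = 0\<close>. The grid times used lie within \<open>2 * \<delta>\<close> of
        \<open>t\<close>, and the iterates move by at most \<open>m * (3 * \<delta>)\<close>, which
        is below \<open>d / 2\<close>.\<close>
      define \<delta> where "\<delta> = d / (8 * (m + 1))"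
      have "\<delta> > 0"
        using \<open>d > 0\<close> \<open>m \<ge> 0\<close> by (simp add: \<delta>_def)
      have "\<delta> * (8 * (m + 1)) = d"
        using \<open>m \<ge> 0\<close> by (simp add: \<delta>_def)
      then have "8 * (\<delta> + m * \<delta>) = d"
        by (simp add: algebra_simps)
      then have \<delta>: "8 * \<delta> \<le> d" "8 * (m * \<delta>) \<le> d"
        using \<open>\<delta> > 0\<close> mult_nonneg_nonneg[OF \<open>m \<ge> 0\<close>, of \<delta>] by auto
      have "(z s' - z s) /\<^sub>R (s' - s) \<in> D"
        if s: "t0 \<le> s" "s < s'" "\<bar>s - t\<bar> < \<delta>" "\<bar>s' - t\<bar> < \<delta>" for s s'
      proof (rule Lim_in_closed_set[OF D(1) _ G(1)])
        \<comment> \<open>Dividing by the difference of the grid times, not by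
          \<open>s' - s\<close>, makes the quotient an exact mean of values of \<open>F\<close>; the
          grid times converge, so the limit is unchanged.\<close>
        let ?\<tau> = "\<lambda>n r. real (node n r) * step n"
        have \<tau>_lim: "((\<lambda>n. ?\<tau> n r) \<longlongrightarrow> r - t0) G" if "t0 \<le> r" for r
        proof (rule tendsto_sandwich[OF _ _ _ tendsto_const])
          show "\<forall>\<^sub>F n in G. r - t0 - step n \<le> ?\<tau> n r" "\<forall>\<^sub>F n in G. ?\<tau> n r \<le> r - t0"
            using node_bounds[OF that] by (auto intro!: always_eventually simp: algebra_simps less_imp_le)
          have "((\<lambda>n. r - t0 - step n) \<longlongrightarrow> r - t0 - 0) G"
            by (intro tendsto_intros step_lim)
          then show "((\<lambda>n. r - t0 - step n) \<longlongrightarrow> r - t0) G"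
            by simp
        qed
        have "((\<lambda>n. (approx_sol n s' - approx_sol n s) /\<^sub>R (?\<tau> n s' - ?\<tau> n s)) \<longlongrightarrow>
            (z s' - z s) /\<^sub>R ((s' - t0) - (s - t0))) G"
          using s by (intro tendsto_intros lim \<tau>_lim) auto
        then show "((\<lambda>n. (approx_sol n s' - approx_sol n s) /\<^sub>R (?\<tau> n s' - ?\<tau> n s)) \<longlongrightarrow> (z s' - z s) /\<^sub>R (s' - s)) G"
          by simp
        \<comment> \<open>A step below \<open>s' - s\<close> separates the two nodes; a step below
          \<open>\<delta> / 2\<close> keeps the intermediate grid times near
          \<open>t\<close>.\<close>
        have "min (\<delta> / 2) (s' - s) > 0"
          using \<open>\<delta> > 0\<close> s by simp
        then have "\<forall>\<^sub>F n in G. step n < min (\<delta> / 2) (s' - s)"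
          by (rule order_tendstoD(2)[OF step_lim])
        moreover have "\<forall>\<^sub>F n in G. dist (approx_sol n t) (z t) < d / 2"
          using \<open>d > 0\<close> by (intro tendstoD[OF lim]) simp
        ultimately show "\<forall>\<^sub>F n in G. (approx_sol n s' - approx_sol n s) /\<^sub>R (?\<tau> n s' - ?\<tau> n s) \<in> D"
        proof eventually_elim
          case (elim n)
          note bs = node_bounds[OF s(1), of n] and bt = node_bounds[OF t, of n]
          have bs': "t0 + ?\<tau> n s' \<le> s'" "s' < t0 + ?\<tau> n s' + step n"
            using node_bounds[of s' n] s by auto
          show ?case
            unfolding approx_sol_def
          proof (rule euler_difference_quotient_mem[OF step_pos _ D(2)])
            have "?\<tau> n s < ?\<tau> n s'"
              using bs(1) bs'(2) elim(1) unfolding min_less_iff_conj by linarith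
            then show "node n s < node n s'"
              using step_pos[of n] by simp
          next
            fix i assume i: "node n s \<le> i" "i < node n s'"
            let ?r = "t0 + real i * step n"
            have "?\<tau> n s \<le> real i * step n" "real i * step n \<le> ?\<tau> n s'"
              using i step_pos[of n] by (auto intro!: mult_right_mono)
            moreover have "step n < \<delta> / 2" "0 \<le> real i * step n"
              using elim(1) step_pos[of n] by auto
            ultimately have r: "\<bar>?r - t\<bar> < 2 * \<delta>" "?r \<le> t + d" "t0 \<le> ?r"
              using bs bs' s(3,4) \<delta>(1) \<open>\<delta> > 0\<close> by linarith+
            \<comment> \<open>The iterates are compared with the one at \<open>node n t\<close>, so
              convergence at the single time \<open>t\<close> is enough and no uniform convergence
              enters.\<close>
            have "dist (euler F t0 z0 (step n) i) (approx_sol n t) \<le> m * \<bar>real i * step n - ?\<tau> n t\<bar>"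
            proof (cases "node n t \<le> i")
              case True
              then have "?\<tau> n t \<le> real i * step n"
                using step_pos[of n] by (auto intro!: mult_right_mono)
              then show ?thesis
                using euler_lipschitz[of "step n" "node n t" i "t + d"] True r step_pos[of n]
                by (simp add: approx_sol_def m_def dist_norm)
            next
              case False
              then have "real i * step n \<le> ?\<tau> n t"
                using step_pos[of n] by (auto intro!: mult_right_mono)
              then show ?thesis
                using euler_lipschitz[of "step n" i "node n t" "t + d"] False bt step_pos[of n] \<open>d > 0\<close>
                by (simp add: approx_sol_def m_def dist_norm norm_minus_commute)
            qed
            also have "\<dots> \<le> m * (3 * \<delta>)"
              using r(1) bt elim(1) \<open>\<delta> > 0\<close> \<open>m \<ge> 0\<close> by (intro mult_left_mono) auto
            also have "\<dots> < d / 2"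
              using \<delta>(2) \<open>d > 0\<close> by simp
            finally have "dist (euler F t0 z0 (step n) i) (z t) < d"
              using elim(2) dist_triangle_lt[of _ "approx_sol n t" "z t" d] dist_triangle[of "euler F t0 z0 (step n) i" "z t" "approx_sol n t"] by linarith
            then show "F ?r (euler F t0 z0 (step n) i) \<in> D"
              using r \<delta>(1) \<open>\<delta> > 0\<close> by (intro near[rule_format]) auto
          qed
        qed
      qed
      with \<open>\<delta> > 0\<close> show "\<exists>\<delta>>0. \<forall>s\<ge>t0. \<forall>s'>s. \<bar>s - t\<bar> < \<delta> \<longrightarrow> \<bar>s' - t\<bar> < \<delta> \<longrightarrow> (z s' - z s) /\<^sub>R (s' - s) \<in> D"
        by blast
    qed
  qed
qed

subsection \<open>The inclusion behind (MITS)\<close>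

text \<open>The variational inequality of the projection: when the squared distance from
  \<open>w\<close> to \<open>c\<close> is expanded around \<open>p\<close>, the cross term has the
  favourable sign.\<close>

lemma closest_point_eqI:
  fixes w :: "'a::euclidean_space"
  assumes "convex K" "closed K" "p \<in> K" and obtuse: "\<And>c. c \<in> K \<Longrightarrow> (w - p) \<bullet> (c - p) \<le> 0"
  shows "closest_point K w = p"
proof -
  have "dist w p \<le> dist w c" if "c \<in> K" for c
  proof -
    have "(norm (w - c))\<^sup>2 = (norm (w - p))\<^sup>2 - 2 * ((w - p) \<bullet> (c - p)) + (norm (c - p))\<^sup>2"
      by (simp add: power2_norm_eq_inner algebra_simps inner_commute)
    then have "(norm (w - p))\<^sup>2 \<le> (norm (w - c))\<^sup>2"
      using obtuse[OF that] zero_le_power2[of "norm (c - p)"] by linarith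
    then show ?thesis
      by (simp add: dist_norm power2_le_iff_abs_le)
  qed
  then show ?thesis
    using closest_point_unique[OF assms(1-3)] by simp
qed

lemma lipschitz_on_imp_abs_continuous_on_interval:
  assumes M: "M-lipschitz_on {a..b} g"
  shows "abs_continuous_on_interval a b g"
  unfolding abs_continuous_on_interval_def
proof (intro allI impI)
  fix \<epsilon> :: real assume "\<epsilon> > 0"
  have "M \<ge> 0"
    using M by (rule lipschitz_on_nonneg)
  show "\<exists>\<delta>>0. \<forall>(k::nat) u v. (\<forall>i<k. a \<le> u i \<and> u i \<le> v i \<and> v i \<le> b) \<and>
      disjoint_family_on (\<lambda>i. {u i<..<v i}) {..<k} \<and> (\<Sum>i<k. v i - u i) < \<delta> \<longrightarrow>
      (\<Sum>i<k. norm (g (v i) - g (u i))) < \<epsilon>"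
  proof (intro exI[of _ "\<epsilon> / (M + 1)"] conjI allI impI; (elim conjE)?)
    show "\<epsilon> / (M + 1) > 0"
      using \<open>\<epsilon> > 0\<close> \<open>M \<ge> 0\<close> by simp
    fix k :: nat and u v :: "nat \<Rightarrow> real"
    assume uv: "\<forall>i<k. a \<le> u i \<and> u i \<le> v i \<and> v i \<le> b" and small: "(\<Sum>i<k. v i - u i) < \<epsilon> / (M + 1)"
    have "(\<Sum>i<k. norm (g (v i) - g (u i))) \<le> (\<Sum>i<k. M * (v i - u i))"
    proof (rule sum_mono)
      fix i assume "i \<in> {..<k}"
      then have "u i \<in> {a..b}" "v i \<in> {a..b}" "u i \<le> v i"
        using uv by force+
      then show "norm (g (v i) - g (u i)) \<le> M * (v i - u i)"
        using lipschitz_onD[OF M, of "v i" "u i"] by (simp add: dist_norm)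
    qed
    also have "\<dots> = M * (\<Sum>i<k. v i - u i)"
      by (simp add: sum_distrib_left)
    also have "\<dots> \<le> M * (\<epsilon> / (M + 1))"
      using small \<open>M \<ge> 0\<close> by (intro mult_left_mono) auto
    also have "\<dots> < \<epsilon>"
      using \<open>\<epsilon> > 0\<close> \<open>M \<ge> 0\<close> by (simp add: field_simps)
    finally show "(\<Sum>i<k. norm (g (v i) - g (u i))) < \<epsilon>" .
  qed
qed

text \<open>Makes the derivative within \<open>{t0..}\<close> unique, including at the end point
  \<open>t0\<close>, where only the right side remains.\<close>

lemma at_within_atLeast_neq_bot:
  fixes t :: real
  assumes "t0 \<le> t"
  shows "at t within {t0..} \<noteq> bot"
proof -
  have "at_right t \<le> at t within {t0..}"
    using assms by (intro at_le) auto
  then show ?thesis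
    using trivial_limit_at_right_real[of t] by (metis bot_unique)
qed

section \<open>Maximizing indices and the projection equation\<close>

definition argmax_set :: "'i set \<Rightarrow> ('i \<Rightarrow> 'a::real_inner) \<Rightarrow> 'a \<Rightarrow> 'i set" where
  "argmax_set I g u = {i\<in>I. \<forall>j\<in>I. u \<bullet> g j \<le> u \<bullet> g i}"

lemma argmax_set_nonempty:
  assumes "finite I" "I \<noteq> {}"
  shows "argmax_set I g u \<noteq> {}"
proof -
  have "Max ((\<lambda>i. u \<bullet> g i) ` I) \<in> (\<lambda>i. u \<bullet> g i) ` I"
    using assms by (intro Max_in) auto
  then obtain i where "i \<in> I" "u \<bullet> g i = Max ((\<lambda>i. u \<bullet> g i) ` I)"
    by auto
  then have "i \<in> argmax_set I g u"
    using assms by (simp add: argmax_set_def)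
  then show ?thesis
    by blast
qed

text \<open>An index that is not maximal in the limit is strictly beaten by another one, and the
  strict inequality persists nearby. With finitely many indices, upper semicontinuity becomes a
  plain inclusion of index sets.\<close>

lemma eventually_argmax_set_subset:
  assumes "finite I" and u: "(u \<longlongrightarrow> u0) \<F>" and g: "\<And>i. i \<in> I \<Longrightarrow> ((\<lambda>x. g x i) \<longlongrightarrow> g0 i) \<F>"
  shows "\<forall>\<^sub>F x in \<F>. argmax_set I (g x) (u x) \<subseteq> argmax_set I g0 u0"
proof -
  have "\<forall>\<^sub>F x in \<F>. i \<in> argmax_set I (g x) (u x) \<longrightarrow> i \<in> argmax_set I g0 u0" if "i \<in> I" for i
  proof (cases "i \<in> argmax_set I g0 u0")
    case False
    then obtain j where j: "j \<in> I" "u0 \<bullet> g0 i < u0 \<bullet> g0 j"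
      using \<open>i \<in> I\<close> by (auto simp: argmax_set_def not_le)
    have "((\<lambda>x. u x \<bullet> g x j - u x \<bullet> g x i) \<longlongrightarrow> u0 \<bullet> g0 j - u0 \<bullet> g0 i) \<F>"
      using that j by (intro tendsto_intros u g)
    then have "\<forall>\<^sub>F x in \<F>. 0 < u x \<bullet> g x j - u x \<bullet> g x i"
      using j by (intro order_tendstoD) auto
    then show ?thesis
      by eventually_elim (use j in \<open>auto simp: argmax_set_def\<close>)
  qed simp
  then have "\<forall>\<^sub>F x in \<F>. \<forall>i\<in>I. i \<in> argmax_set I (g x) (u x) \<longrightarrow> i \<in> argmax_set I g0 u0"
    using \<open>finite I\<close> by (intro eventually_ball_finite) auto
  then show ?thesis
    by eventually_elim (auto simp: argmax_set_def)
qed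

text \<open>Put \<open>p = - a - \<kappa> *\<^sub>R u\<close>. Then \<open>p\<close> maximizes the
  inner product with \<open>u\<close> over the scaled hull, and \<open>- a - p\<close> equals
  \<open>\<kappa> *\<^sub>R u\<close>, so this maximality with \<open>\<kappa> \<ge> 0\<close> is
  the variational inequality for \<open>p\<close> as the projection of \<open>- a\<close>.\<close>

lemma convex_hull_argmax_imp_closest_point:
  fixes u a :: "'a::euclidean_space"
  assumes "finite I" "b > 0" "\<kappa> \<ge> 0"
    and a: "a \<in> convex hull ((\<lambda>i. - (\<kappa> *\<^sub>R u) - b *\<^sub>R g i) ` argmax_set I g u)"
  shows "a + \<kappa> *\<^sub>R u + closest_point ((\<lambda>c. b *\<^sub>R c) ` (convex hull (g ` I))) (- a) = 0"
proof -
  define K where "K = (\<lambda>c. b *\<^sub>R c) ` (convex hull (g ` I))"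
  have K: "convex K" "closed K"
    using \<open>finite I\<close> unfolding K_def
    by (auto intro!: convex_scaling compact_imp_closed compact_scaling finite_imp_compact_convex_hull)
  \<comment> \<open>The accelerations whose associated \<open>p\<close> lies in \<open>K\<close> and
    is maximal there. This set is convex, so only the generators of the hull need checking.\<close>
  define H where "H = {v. - v - \<kappa> *\<^sub>R u \<in> K \<and> (\<forall>c\<in>K. u \<bullet> c \<le> u \<bullet> (- v - \<kappa> *\<^sub>R u))}"
  have "convex hull ((\<lambda>i. - (\<kappa> *\<^sub>R u) - b *\<^sub>R g i) ` argmax_set I g u) \<subseteq> H"
  proof (rule hull_minimal)
    show "(\<lambda>i. - (\<kappa> *\<^sub>R u) - b *\<^sub>R g i) ` argmax_set I g u \<subseteq> H"
    proof clarify
      fix i assume i: "i \<in> argmax_set I g u"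
      have "convex hull (g ` I) \<subseteq> {d. u \<bullet> d \<le> u \<bullet> g i}"
        using i by (intro hull_minimal convex_halfspace_le) (auto simp: argmax_set_def)
      then have "\<forall>c\<in>K. u \<bullet> c \<le> b * (u \<bullet> g i)"
        using \<open>b > 0\<close> by (auto simp: K_def)
      moreover have "b *\<^sub>R g i \<in> K"
        using i by (auto simp: K_def argmax_set_def intro!: imageI hull_inc)
      ultimately show "- (\<kappa> *\<^sub>R u) - b *\<^sub>R g i \<in> H"
        by (simp add: H_def)
    qed
    show "convex H"
    proof (rule convexI)
      fix v w and p q :: real assume vw: "v \<in> H" "w \<in> H" and pq: "0 \<le> p" "0 \<le> q" "p + q = 1"
      have eq: "- (p *\<^sub>R v + q *\<^sub>R w) - \<kappa> *\<^sub>R u = p *\<^sub>R (- v - \<kappa> *\<^sub>R u) + q *\<^sub>R (- w - \<kappa> *\<^sub>R u)"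
      proof -
        have "\<kappa> *\<^sub>R u = p *\<^sub>R (\<kappa> *\<^sub>R u) + q *\<^sub>R (\<kappa> *\<^sub>R u)"
          using pq(3) by (metis scaleR_add_left scaleR_one)
        then have "- (p *\<^sub>R v + q *\<^sub>R w) - \<kappa> *\<^sub>R u =
            - (p *\<^sub>R v + q *\<^sub>R w) - (p *\<^sub>R (\<kappa> *\<^sub>R u) + q *\<^sub>R (\<kappa> *\<^sub>R u))"
          by (rule arg_cong)
        also have "\<dots> = p *\<^sub>R (- v - \<kappa> *\<^sub>R u) + q *\<^sub>R (- w - \<kappa> *\<^sub>R u)"
          by (simp add: scaleR_diff_right)
        finally show ?thesis .
      qed
      have "u \<bullet> c \<le> u \<bullet> (p *\<^sub>R (- v - \<kappa> *\<^sub>R u) + q *\<^sub>R (- w - \<kappa> *\<^sub>R u))" if "c \<in> K" for c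
      proof -
        have "u \<bullet> c \<le> u \<bullet> (- v - \<kappa> *\<^sub>R u)" "u \<bullet> c \<le> u \<bullet> (- w - \<kappa> *\<^sub>R u)"
          using vw that by (auto simp: H_def)
        then have "p * (u \<bullet> c) + q * (u \<bullet> c) \<le> p * (u \<bullet> (- v - \<kappa> *\<^sub>R u)) + q * (u \<bullet> (- w - \<kappa> *\<^sub>R u))"
          using pq by (intro add_mono mult_left_mono)
        then show ?thesis
          using pq(3) by (simp only: inner_add_right inner_scaleR_right mult_1 flip: distrib_right)
      qed
      moreover have "p *\<^sub>R (- v - \<kappa> *\<^sub>R u) + q *\<^sub>R (- w - \<kappa> *\<^sub>R u) \<in> K"
        using vw pq K(1) by (auto simp: H_def intro!: convexD)
      ultimately show "p *\<^sub>R v + q *\<^sub>R w \<in> H"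
        unfolding H_def mem_Collect_eq eq by blast
    qed
  qed
  with a have "a \<in> H"
    by blast
  then have p: "- a - \<kappa> *\<^sub>R u \<in> K" "\<And>c. c \<in> K \<Longrightarrow> u \<bullet> c \<le> u \<bullet> (- a - \<kappa> *\<^sub>R u)"
    by (auto simp: H_def)
  have "closest_point K (- a) = - a - \<kappa> *\<^sub>R u"
  proof (rule closest_point_eqI[OF K p(1)])
    fix c assume "c \<in> K"
    have "(- a - (- a - \<kappa> *\<^sub>R u)) \<bullet> (c - (- a - \<kappa> *\<^sub>R u)) = \<kappa> * (u \<bullet> c - u \<bullet> (- a - \<kappa> *\<^sub>R u))"
      by (simp add: inner_diff_right right_diff_distrib)
    also have "\<dots> \<le> 0"
      using p(2)[OF \<open>c \<in> K\<close>] \<open>\<kappa> \<ge> 0\<close> by (simp add: mult_nonneg_nonpos)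
    finally show "(- a - (- a - \<kappa> *\<^sub>R u)) \<bullet> (c - (- a - \<kappa> *\<^sub>R u)) \<le> 0" .
  qed
  then show ?thesis
    by (simp add: K_def)
qed

text \<open>The pair of position and velocity is a Krasovskii limit for a selection of maximizing
  gradients. Its velocity part is locally Lipschitz, and wherever its derivative exists, that
  derivative lies in \<open>W t\<close>, which \<open>convex_hull_argmax_imp_closest_point\<close>
  turns into the projection equation.\<close>

lemma MITS_solution_exists:
  fixes f :: "nat \<Rightarrow> 'a::euclidean_space \<Rightarrow> real"
  assumes "t0 > 0" "\<alpha> > 0" "m \<ge> 1"
    and \<beta>_pos: "\<And>t. t \<ge> t0 \<Longrightarrow> \<beta> t > 0"
    and \<beta>_cont: "continuous_on {t0..} \<beta>"
    and \<beta>_mono: "mono_on {t0..} \<beta>"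
    and lip: "\<And>i. i \<in> {1..m} \<Longrightarrow> L-lipschitz_on UNIV (gradient (f i))"
  shows "\<exists>x. MITS_solution t0 \<alpha> \<beta> m f x0 v0 x"
proof -
  define I where "I = {1..m}"
  define g where "g \<equiv> \<lambda>y i. gradient (f i) y"
  \<comment> \<open>Freezing the coefficients at their values at \<open>t0\<close> for earlier times
    gives continuity and positivity on the whole line, so ordinary neighbourhoods can be used even
    at \<open>t0\<close>.\<close>
  define \<beta>' where "\<beta>' \<equiv> \<lambda>t. \<beta> (max t0 t)"
  define acc where "acc \<equiv> \<lambda>r z i. - ((\<alpha> / max t0 r) *\<^sub>R snd z) - \<beta>' r *\<^sub>R g (fst z) i"
  \<comment> \<open>Ties between maximizing gradients are broken arbitrarily; the resulting
    \<open>F\<close> may be discontinuous.\<close>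
  define idx where "idx \<equiv> \<lambda>z. SOME i. i \<in> argmax_set I (g (fst z)) (snd z)"
  define F where "F \<equiv> \<lambda>r z. (snd z, acc r z (idx z))"
  have "finite I" "I \<noteq> {}"
    using \<open>m \<ge> 1\<close> by (auto simp: I_def)
  then have "1 \<in> I"
    by (auto simp: I_def)
  have idx: "idx z \<in> argmax_set I (g (fst z)) (snd z)" for z
    unfolding idx_def by (rule someI_ex) (use argmax_set_nonempty[OF \<open>finite I\<close> \<open>I \<noteq> {}\<close>] in blast)
  then have idx_I: "idx z \<in> I" for z
    by (auto simp: argmax_set_def)
  have "L \<ge> 0"
    using lip[of 1] \<open>1 \<in> I\<close> lipschitz_on_nonneg unfolding I_def by blast
  have \<beta>'_pos: "\<beta>' t > 0" for t
    using \<beta>_pos by (simp add: \<beta>'_def)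
  have \<beta>'_cont: "isCont \<beta>' t" for t
  proof -
    have "continuous_on UNIV \<beta>'"
      unfolding \<beta>'_def by (rule continuous_on_compose2[OF \<beta>_cont]) (auto intro!: continuous_intros)
    then show ?thesis
      by (simp add: continuous_on_eq_continuous_at)
  qed
  have g_lip: "norm (g y i - g y' i) \<le> L * norm (y - y')" if "i \<in> I" for i y y'
    using lipschitz_onD[OF lip, of i y y'] that by (simp add: I_def g_def dist_norm)
  have g_cont: "isCont (\<lambda>y. g y i) y" if "i \<in> I" for i y
  proof -
    have "continuous_on UNIV (\<lambda>y. g y i)"
      unfolding g_def using lip that by (intro lipschitz_on_continuous_on) (auto simp: I_def)
    then show ?thesis
      by (simp add: continuous_on_eq_continuous_at)
  qed
  define G where "G = (\<Sum>i\<in>I. norm (g 0 i)) + L"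
  have "G \<ge> 0"
    using \<open>L \<ge> 0\<close> by (auto simp: G_def intro!: add_nonneg_nonneg sum_nonneg)
  have g_growth: "norm (g y i) \<le> G * (1 + norm y)" if "i \<in> I" for i y
  proof -
    have "norm (g y i) \<le> norm (g 0 i) + L * norm y"
      using g_lip[OF that, of y 0] norm_triangle_ineq2[of "g y i" "g 0 i"] by simp
    also have "norm (g 0 i) \<le> (\<Sum>i\<in>I. norm (g 0 i))"
      using that \<open>finite I\<close> by (intro member_le_sum) auto
    also have "(\<Sum>i\<in>I. norm (g 0 i)) + L * norm y \<le> G * (1 + norm y)"
      using \<open>L \<ge> 0\<close> by (simp add: G_def algebra_simps sum_nonneg)
    finally show ?thesis
      by simp
  qed
  \<comment> \<open>The three summands bound the velocity component, the damping term and the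
    gradient term; monotonicity in time comes from that of \<beta>.\<close>
  define c where "c \<equiv> \<lambda>t. 1 + \<alpha> / t0 + \<beta>' t * G"
  have F_growth: "norm (F t z) \<le> c t * (1 + norm z)" for t z
  proof -
    have "norm (F t z) \<le> norm (snd z) + norm (acc t z (idx z))"
      unfolding F_def by (rule norm_Pair_le)
    also have "norm (acc t z (idx z)) \<le> \<alpha> / max t0 t * norm (snd z) + \<beta>' t * norm (g (fst z) (idx z))"
      using norm_triangle_ineq4[of "- ((\<alpha> / max t0 t) *\<^sub>R snd z)" "\<beta>' t *\<^sub>R g (fst z) (idx z)"]
        \<open>t0 > 0\<close> \<open>\<alpha> > 0\<close> \<beta>'_pos[of t] by (simp add: acc_def)
    also have "\<beta>' t * norm (g (fst z) (idx z)) \<le> \<beta>' t * (G * (1 + norm z))"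
    proof (rule mult_left_mono)
      have "G * (1 + norm (fst z)) \<le> G * (1 + norm z)"
        using \<open>G \<ge> 0\<close> norm_fst_le[of "fst z" "snd z"] by (intro mult_left_mono) auto
      then show "norm (g (fst z) (idx z)) \<le> G * (1 + norm z)"
        using g_growth[OF idx_I] order_trans by blast
    qed (use \<beta>'_pos[of t] in simp)
    also have "\<alpha> / max t0 t * norm (snd z) \<le> \<alpha> / t0 * (1 + norm z)"
      using \<open>t0 > 0\<close> \<open>\<alpha> > 0\<close> norm_snd_le[of "snd z" "fst z"] by (intro mult_mono divide_left_mono) auto
    also have "norm (snd z) \<le> 1 + norm z"
      using norm_snd_le[of "snd z" "fst z"] by simp
    finally show ?thesis
      by (simp add: c_def algebra_simps)
  qed
  have c_mono: "c s \<le> c t" if "t0 \<le> s" "s \<le> t" for s t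
    unfolding c_def \<beta>'_def using that \<open>G \<ge> 0\<close>
    by (intro add_left_mono mult_right_mono mono_onD[OF \<beta>_mono]) auto
  obtain z where z0: "z t0 = (x0, v0)" and z_lip: "\<forall>T. \<exists>M. M-lipschitz_on {t0..T} z"
    and z_inclusion: "\<forall>t D. t0 \<le> t \<longrightarrow> closed D \<longrightarrow> convex D \<longrightarrow>
      (\<exists>d>0. \<forall>r\<ge>t0. \<forall>y. \<bar>r - t\<bar> < d \<longrightarrow> dist y (z t) < d \<longrightarrow> F r y \<in> D) \<longrightarrow>
      (\<exists>\<delta>>0. \<forall>s\<ge>t0. \<forall>s'>s. \<bar>s - t\<bar> < \<delta> \<longrightarrow> \<bar>s' - t\<bar> < \<delta> \<longrightarrow> (z s' - z s) /\<^sub>R (s' - s) \<in> D)"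
    by (rule krasovskii_solution_exists[of t0 F c "(x0, v0)"]) (use F_growth c_mono in auto)
  define x u where "x \<equiv> \<lambda>t. fst (z t)" and "u \<equiv> \<lambda>t. snd (z t)"
  define W where "W \<equiv> \<lambda>t. convex hull (acc t (z t) ` argmax_set I (g (x t)) (u t))"
  have W_compact: "compact (W t)" for t
    unfolding W_def using \<open>finite I\<close> by (intro finite_imp_compact_convex_hull) (simp add: argmax_set_def)
  have quotient: "\<exists>\<delta>>0. \<forall>s\<ge>t0. \<forall>s'>s. \<bar>s - t\<bar> < \<delta> \<longrightarrow> \<bar>s' - t\<bar> < \<delta> \<longrightarrow>
      norm ((x s' - x s) /\<^sub>R (s' - s) - u t) \<le> \<epsilon> \<and>
      (\<exists>w\<in>W t. norm ((u s' - u s) /\<^sub>R (s' - s) - w) \<le> \<epsilon>)" if "t0 \<le> t" "\<epsilon> > 0" for t \<epsilon>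
  proof -
    define D where "D = {v + e | v e. v \<in> {u t} \<times> W t \<and> e \<in> cball 0 \<epsilon>}"
    have D1: "closed D"
      unfolding D_def using W_compact by (intro compact_imp_closed compact_sums compact_Times) auto
    have D2: "convex D"
    proof -
      have "D = (\<Union>v\<in>{u t} \<times> W t. \<Union>e\<in>cball 0 \<epsilon>. {v + e})"
        unfolding D_def by blast
      then show ?thesis
        by (simp only:) (intro convex_sums convex_Times convex_singleton convex_cball; simp add: W_def)
    qed
    have D3: "\<exists>d>0. \<forall>r\<ge>t0. \<forall>y. \<bar>r - t\<bar> < d \<longrightarrow> dist y (z t) < d \<longrightarrow> F r y \<in> D"
    proof -
      \<comment> \<open>Upper semicontinuity in time and state jointly: near \<open>(t, z t)\<close>
        the selected index is already maximal at \<open>(t, z t)\<close>, and for a fixed index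
        \<open>acc\<close> is continuous.\<close>
      let ?\<F> = "nhds (t, z t)"
      have lim_r: "(fst \<longlongrightarrow> t) ?\<F>" and lim_z: "(snd \<longlongrightarrow> z t) ?\<F>"
        using tendsto_fst[OF filterlim_ident, of "(t, z t)"] tendsto_snd[OF filterlim_ident, of "(t, z t)"] by simp_all
      have lim_x: "((\<lambda>p. fst (snd p)) \<longlongrightarrow> x t) ?\<F>" and lim_u: "((\<lambda>p. snd (snd p)) \<longlongrightarrow> u t) ?\<F>"
        unfolding x_def u_def by (intro tendsto_fst[OF lim_z] tendsto_snd[OF lim_z])+
      have lim_g: "((\<lambda>p. g (fst (snd p)) i) \<longlongrightarrow> g (x t) i) ?\<F>" if "i \<in> I" for i
        by (rule isCont_tendsto_compose[OF g_cont[OF that] lim_x])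
      have lim_acc: "((\<lambda>p. acc (fst p) (snd p) i) \<longlongrightarrow> acc t (z t) i) ?\<F>" if "i \<in> I" for i
        unfolding acc_def using \<open>t0 > 0\<close>
        by (intro tendsto_intros lim_u[unfolded u_def] lim_g[OF that, unfolded x_def] lim_r isCont_tendsto_compose[OF \<beta>'_cont]) auto
      have "\<forall>\<^sub>F p in ?\<F>. argmax_set I (g (fst (snd p))) (snd (snd p)) \<subseteq> argmax_set I (g (x t)) (u t)"
        by (intro eventually_argmax_set_subset lim_u lim_g \<open>finite I\<close>)
      moreover have "\<forall>\<^sub>F p in ?\<F>. dist (snd (snd p)) (u t) < \<epsilon> / 2"
        using \<open>\<epsilon> > 0\<close> by (intro tendstoD[OF lim_u]) simp
      moreover have "\<forall>\<^sub>F p in ?\<F>. \<forall>i\<in>I. dist (acc (fst p) (snd p) i) (acc t (z t) i) < \<epsilon> / 2"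
        using \<open>\<epsilon> > 0\<close> \<open>finite I\<close> by (intro eventually_ball_finite ballI tendstoD[OF lim_acc]) auto
      ultimately have "\<forall>\<^sub>F p in ?\<F>. F (fst p) (snd p) \<in> D"
      proof eventually_elim
        case (elim p)
        define i where "i = idx (snd p)"
        have i: "i \<in> I" "i \<in> argmax_set I (g (x t)) (u t)"
          using elim(1) idx[of "snd p"] idx_I unfolding i_def by blast+
        have "norm (snd (snd p) - u t, acc (fst p) (snd p) i - acc t (z t) i) \<le> \<epsilon> / 2 + \<epsilon> / 2"
          using elim(2,3) i(1) norm_Pair_le[of "snd (snd p) - u t" "acc (fst p) (snd p) i - acc t (z t) i"]
          by (fastforce simp: dist_norm)
        then have "(snd (snd p) - u t, acc (fst p) (snd p) i - acc t (z t) i) \<in> cball 0 \<epsilon>"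
          by simp
        moreover have "(u t, acc t (z t) i) \<in> {u t} \<times> W t"
          using i by (auto simp: W_def intro: hull_inc)
        moreover have "F (fst p) (snd p) =
            (u t, acc t (z t) i) + (snd (snd p) - u t, acc (fst p) (snd p) i - acc t (z t) i)"
          by (simp add: F_def i_def)
        ultimately show ?case
          unfolding D_def by blast
      qed
      then obtain d where "d > 0" and d: "\<And>p. dist p (t, z t) < d \<Longrightarrow> F (fst p) (snd p) \<in> D"
        unfolding eventually_nhds_metric by blast
      have "F r y \<in> D" if "\<bar>r - t\<bar> < d / 2" "dist y (z t) < d / 2" for r y
      proof -
        have "dist (r, y) (t, z t) \<le> \<bar>r - t\<bar> + dist y (z t)"
          unfolding dist_Pair_Pair by (rule order_trans[OF sqrt_sum_squares_le_sum]) (simp_all add: dist_real_def)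
        then show ?thesis
          using d[of "(r, y)"] that by simp
      qed
      with \<open>d > 0\<close> show ?thesis
        by (intro exI[of _ "d / 2"]) auto
    qed
    from z_inclusion[rule_format, OF \<open>t0 \<le> t\<close> D1 D2 D3]
    obtain \<delta> where "\<delta> > 0" and \<delta>': "\<forall>s\<ge>t0. \<forall>s'>s. \<bar>s - t\<bar> < \<delta> \<longrightarrow> \<bar>s' - t\<bar> < \<delta> \<longrightarrow>
        (z s' - z s) /\<^sub>R (s' - s) \<in> D"
      by blast
    note \<delta> = \<delta>'[rule_format]
    have "norm ((x s' - x s) /\<^sub>R (s' - s) - u t) \<le> \<epsilon> \<and>
        (\<exists>w\<in>W t. norm ((u s' - u s) /\<^sub>R (s' - s) - w) \<le> \<epsilon>)"
      if ss: "t0 \<le> s" "s < s'" "\<bar>s - t\<bar> < \<delta>" "\<bar>s' - t\<bar> < \<delta>" for s s'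
    proof -
      obtain w e where w: "w \<in> W t" and e: "norm e \<le> \<epsilon>" and "(z s' - z s) /\<^sub>R (s' - s) = (u t, w) + e"
        using \<delta>[OF ss] by (auto simp: D_def)
      then have "(x s' - x s) /\<^sub>R (s' - s) = u t + fst e" "(u s' - u s) /\<^sub>R (s' - s) = w + snd e"
        by (auto simp: x_def u_def prod_eq_iff)
      moreover have "norm (fst e) \<le> \<epsilon>" "norm (snd e) \<le> \<epsilon>"
        using e norm_fst_le[of "fst e" "snd e"] norm_snd_le[of "snd e" "fst e"] by simp_all
      ultimately show ?thesis
        using w by (auto intro!: bexI[of _ w])
    qed
    with \<open>\<delta> > 0\<close> show ?thesis
      by blast
  qed
  \<comment> \<open>The first factor of \<open>{u t} \<times> W t\<close> is a single point, so
    \<open>x\<close> is differentiable at every time. The second factor only confines the derivative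
    of \<open>u\<close> where it exists.\<close>
  have x_deriv: "(x has_vector_derivative u t) (at t within {t0..})" if "t0 \<le> t" for t
    unfolding has_vector_derivative_def has_derivative_within_alt
  proof (intro conjI allI impI)
    fix e :: real assume "e > 0"
    obtain \<delta> where "\<delta> > 0" and \<delta>': "\<forall>s\<ge>t0. \<forall>s'>s. \<bar>s - t\<bar> < \<delta> \<longrightarrow> \<bar>s' - t\<bar> < \<delta> \<longrightarrow>
        norm ((x s' - x s) /\<^sub>R (s' - s) - u t) \<le> e"
      using quotient[OF \<open>t0 \<le> t\<close> \<open>e > 0\<close>] by blast
    note \<delta> = \<delta>'[rule_format]
    have *: "norm (x s' - x s - (s' - s) *\<^sub>R u t) \<le> e * (s' - s)"
      if "t0 \<le> s" "s < s'" "\<bar>s - t\<bar> < \<delta>" "\<bar>s' - t\<bar> < \<delta>" for s s'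
    proof -
      have "x s' - x s - (s' - s) *\<^sub>R u t = (s' - s) *\<^sub>R ((x s' - x s) /\<^sub>R (s' - s) - u t)"
        using that by (simp add: scaleR_diff_right)
      then show ?thesis
        using \<delta>[OF that] that by (simp add: mult.commute mult_left_mono)
    qed
    have "norm (x y - x t - (y - t) *\<^sub>R u t) \<le> e * norm (y - t)" if y: "y \<in> {t0..}" "norm (y - t) < \<delta>" for y
    proof (cases y t rule: linorder_cases)
      case less
      have "x y - x t - (y - t) *\<^sub>R u t = - (x t - x y - (t - y) *\<^sub>R u t)"
        by (simp add: algebra_simps)
      then show ?thesis
        using *[of y t] less y \<open>\<delta> > 0\<close> by (simp only: norm_minus_cancel) simp
    next
      case greater
      then show ?thesis
        using *[of t y] y \<open>\<delta> > 0\<close> \<open>t0 \<le> t\<close> by simp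
    qed simp
    with \<open>\<delta> > 0\<close> show "\<exists>d>0. \<forall>y\<in>{t0..}. norm (y - t) < d \<longrightarrow>
        norm (x y - x t - (y - t) *\<^sub>R u t) \<le> e * norm (y - t)"
      by blast
  qed (rule bounded_linear_scaleR_left)
  have u_deriv: "a \<in> W t" if "t0 \<le> t" and a: "(u has_vector_derivative a) (at t within {t0..})" for a t
  proof -
    have "\<exists>w\<in>W t. dist w a < e" if "e > 0" for e
    proof -
      have "e / 3 > 0"
        using that by simp
      obtain \<delta> where "\<delta> > 0" and \<delta>': "\<forall>s\<ge>t0. \<forall>s'>s. \<bar>s - t\<bar> < \<delta> \<longrightarrow> \<bar>s' - t\<bar> < \<delta> \<longrightarrow>
          (\<exists>w\<in>W t. norm ((u s' - u s) /\<^sub>R (s' - s) - w) \<le> e / 3)"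
        using quotient[OF \<open>t0 \<le> t\<close> \<open>e / 3 > 0\<close>] by blast
      note \<delta> = \<delta>'[rule_format]
      have "\<forall>e>0. \<exists>d>0. \<forall>y\<in>{t0..}. norm (y - t) < d \<longrightarrow>
          norm (u y - u t - (y - t) *\<^sub>R a) \<le> e * norm (y - t)"
        using a unfolding has_vector_derivative_def has_derivative_within_alt by blast
      from this[rule_format, OF \<open>e / 3 > 0\<close>] obtain d where "d > 0" and d': "\<forall>y\<in>{t0..}. norm (y - t) < d \<longrightarrow>
          norm (u y - u t - (y - t) *\<^sub>R a) \<le> e / 3 * norm (y - t)"
        by blast
      have d: "norm (u y - u t - (y - t) *\<^sub>R a) \<le> e / 3 * \<bar>y - t\<bar>" if "t0 \<le> y" "\<bar>y - t\<bar> < d" for y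
        using d' that by simp
      \<comment> \<open>A point to the right of \<open>t\<close> stays in the domain also when
        \<open>t = t0\<close>.\<close>
      define y where "y = t + min d \<delta> / 2"
      have y: "t < y" "\<bar>y - t\<bar> < d" "\<bar>y - t\<bar> < \<delta>"
        using \<open>d > 0\<close> \<open>\<delta> > 0\<close> by (auto simp: y_def min_def)
      obtain w where w: "w \<in> W t" "norm ((u y - u t) /\<^sub>R (y - t) - w) \<le> e / 3"
        using \<delta>[of t y] y \<open>\<delta> > 0\<close> \<open>t0 \<le> t\<close> by auto
      have "(u y - u t) /\<^sub>R (y - t) - a = (u y - u t - (y - t) *\<^sub>R a) /\<^sub>R (y - t)"
        using y by (simp add: scaleR_diff_right)
      then have "norm ((u y - u t) /\<^sub>R (y - t) - a) = norm (u y - u t - (y - t) *\<^sub>R a) / (y - t)"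
        using y by (simp only: norm_scaleR) (simp add: divide_inverse mult.commute)
      also have "\<dots> \<le> e / 3"
        using d[of y] y \<open>t0 \<le> t\<close> by (subst pos_divide_le_eq) auto
      finally have "norm ((u y - u t) /\<^sub>R (y - t) - a) \<le> e / 3" .
      then have "norm (w - a) \<le> e / 3 + e / 3"
        using w(2) norm_triangle_ineq4[of "(u y - u t) /\<^sub>R (y - t) - a" "(u y - u t) /\<^sub>R (y - t) - w"] by simp
      then show ?thesis
        using w(1) that by (intro bexI[of _ w]) (auto simp: dist_norm)
    qed
    then show ?thesis
      using closed_approachable[OF compact_imp_closed[OF W_compact]] by blast
  qed
  have xdot: "vector_derivative x (at t within {t0..}) = u t" if "t0 \<le> t" for t
    using x_deriv[OF that] at_within_atLeast_neq_bot[OF that] by (rule vector_derivative_within[rotated])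
  have u_lip: "\<exists>M. M-lipschitz_on {t0..T} u" for T
  proof -
    obtain M where M: "M-lipschitz_on {t0..T} z"
      using z_lip by blast
    have "M-lipschitz_on {t0..T} u"
    proof (rule lipschitz_onI)
      fix s t assume "s \<in> {t0..T}" "t \<in> {t0..T}"
      then show "dist (u s) (u t) \<le> M * dist s t"
        using lipschitz_onD[OF M, of s t] dist_snd_le[of "z s" "z t"] by (simp add: u_def)
    qed (use M lipschitz_on_nonneg in blast)
    then show ?thesis
      by blast
  qed
  \<comment> \<open>A constant continuation to the left of \<open>t0\<close>, because the
    differentiation result expects a function that is Lipschitz on every bounded interval of the
    line.\<close>
  define u' where "u' \<equiv> \<lambda>t. u (max t0 t)"
  have u'_lip: "\<exists>M. M-lipschitz_on {a..b} u'" for a b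
  proof -
    obtain M where M: "M-lipschitz_on {t0..max t0 b} u"
      using u_lip by blast
    have "M-lipschitz_on {a..b} u'"
    proof (rule lipschitz_onI)
      show "M \<ge> 0"
        using M by (rule lipschitz_on_nonneg)
      fix s t assume "s \<in> {a..b}" "t \<in> {a..b}"
      then have "dist (u' s) (u' t) \<le> M * dist (max t0 s) (max t0 t)"
        unfolding u'_def by (intro lipschitz_onD[OF M]) auto
      also have "\<dots> \<le> M * dist s t"
        using \<open>M \<ge> 0\<close> by (intro mult_left_mono) (auto simp: dist_real_def)
      finally show "dist (u' s) (u' t) \<le> M * dist s t" .
    qed
    then show ?thesis
      by blast
  qed
  have "\<exists>a. a \<in> borel_measurable borel \<and> (\<forall>p q. \<exists>B. \<forall>t\<in>{p..q}. norm (a t) \<le> B) \<and>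
      (\<forall>p q. p \<le> q \<longrightarrow> (a has_integral (u' q - u' p)) {p..q}) \<and>
      negligible {t. \<not> (u' has_vector_derivative a t) (at t)}"
  proof (rule lipschitz_imp_integral_of_derivative_ae[OF u'_lip])
    fix a :: "real \<Rightarrow> 'a"
    assume a: "a \<in> borel_measurable borel" "\<And>p q. \<exists>B. \<forall>t\<in>{p..q}. norm (a t) \<le> B"
      "\<And>p q. p \<le> q \<Longrightarrow> (a has_integral (u' q - u' p)) {p..q}"
      "negligible {t. \<not> (u' has_vector_derivative a t) (at t)}"
    show ?thesis
      by (intro exI[of _ a] conjI allI impI a)
  qed
  then obtain a where a_meas: "a \<in> borel_measurable borel"
    and a_bound: "\<And>p q. \<exists>B. \<forall>t\<in>{p..q}. norm (a t) \<le> B"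
    and a_int: "\<And>p q. p \<le> q \<Longrightarrow> (a has_integral (u' q - u' p)) {p..q}"
    and a_deriv: "negligible {t. \<not> (u' has_vector_derivative a t) (at t)}"
    by auto
  have a_meas_lebesgue: "a \<in> borel_measurable lebesgue"
    using a_meas by (intro measurable_completion) simp
  \<comment> \<open>The conjunct \<open>t0 \<le> t\<close> is carried along because both
    \<open>xdot\<close> and \<open>u_deriv\<close> ask for it pointwise.\<close>
  have AE_deriv: "AE t in lebesgue_on {t0..}. t0 \<le> t \<and> (u has_vector_derivative a t) (at t within {t0..})"
  proof -
    have "AE t in lebesgue. (u' has_vector_derivative a t) (at t)"
      by (rule AE_I'[of "{t. \<not> (u' has_vector_derivative a t) (at t)}"])
         (use a_deriv negligible_iff_null_sets in auto)
    then have "AE t in lebesgue. t \<in> {t0..} \<longrightarrow> t0 \<le> t \<and> (u has_vector_derivative a t) (at t within {t0..})"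
    proof eventually_elim
      case (elim t)
      have "(u has_vector_derivative a t) (at t within {t0..})" if "t0 \<le> t"
      proof (rule has_vector_derivative_transform[of _ _ _ u'])
        show "(u' has_vector_derivative a t) (at t within {t0..})"
          using elim by (rule has_vector_derivative_at_within)
      qed (use that in \<open>auto simp: u'_def\<close>)
      then show ?case
        by simp
    qed
    then show ?thesis
      by (subst AE_restrict_space_iff) auto
  qed
  have "MITS_solution t0 \<alpha> \<beta> m f x0 v0 x"
    unfolding MITS_solution_def Let_def
  proof (intro conjI allI impI exI[of _ a])
    have "continuous_on {t0..} u"
    proof (rule continuous_on_eq)
      show "continuous_on {t0..} u'"
        using lipschitz_on_intervals_imp_isCont[OF u'_lip] by (simp add: continuous_at_imp_continuous_on)
    qed (simp add: u'_def max_def)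
    then have "continuous_on {t0..} (\<lambda>t. vector_derivative x (at t within {t0..}))"
      by (rule continuous_on_eq) (simp add: xdot)
    then show "continuously_differentiable_on {t0..} x"
      unfolding continuously_differentiable_on_def by (auto intro: differentiableI_vector x_deriv)
  next
    fix T assume "t0 \<le> T"
    obtain M where M: "M-lipschitz_on {t0..T} u"
      using u_lip by blast
    then have "M-lipschitz_on {t0..T} (\<lambda>t. vector_derivative x (at t within {t0..}))"
      by (rule lipschitz_on_transform) (simp add: xdot)
    then show "abs_continuous_on_interval t0 T (\<lambda>t. vector_derivative x (at t within {t0..}))"
      by (rule lipschitz_on_imp_abs_continuous_on_interval)
  next
    show "a \<in> borel_measurable (lebesgue_on {t0..})"
      using a_meas_lebesgue by (rule measurable_restrict_space1)
  next
    fix t assume "t0 \<le> t"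
    obtain B where B: "\<forall>s\<in>{t0..t}. norm (a s) \<le> B"
      using a_bound by blast
    show int: "set_integrable lebesgue {t0..t} a"
      unfolding set_integrable_def using B a_meas_lebesgue \<open>t0 \<le> t\<close>
      by (intro integrableI_bounded_set_indicator[of _ _ _ B]) auto
    \<comment> \<open>\<open>a_int\<close> is a gauge integral; for the set-integrable
      \<open>a\<close> it agrees with the Lebesgue integral.\<close>
    show "vector_derivative x (at t within {t0..}) =
        vector_derivative x (at t0 within {t0..}) + (LINT s:{t0..t}|lebesgue. a s)"
      using a_int[OF \<open>t0 \<le> t\<close>] \<open>t0 \<le> t\<close> set_lebesgue_integral_eq_integral(2)[OF int]
      by (simp add: xdot u'_def integral_unique)
  next
    show "AE t in lebesgue_on {t0..}.
        ((\<lambda>t. vector_derivative x (at t within {t0..})) has_vector_derivative a t) (at t within {t0..})"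
      using AE_deriv
    proof eventually_elim
      case (elim t)
      then show ?case
        by (auto intro: has_vector_derivative_transform simp: xdot)
    qed
  next
    show "AE t in lebesgue_on {t0..}. a t + (\<alpha> / t) *\<^sub>R vector_derivative x (at t within {t0..}) +
        closest_point ((\<lambda>c. \<beta> t *\<^sub>R c) ` grad_hull m f (x t)) (- a t) = 0"
      using AE_deriv
    proof eventually_elim
      case (elim t)
      then have "a t \<in> W t"
        using u_deriv by blast
      moreover have "acc t (z t) = (\<lambda>i. - ((\<alpha> / t) *\<^sub>R u t) - \<beta> t *\<^sub>R g (x t) i)"
        using elim by (auto simp: acc_def u_def x_def \<beta>'_def)
      ultimately have "a t + (\<alpha> / t) *\<^sub>R u t +
          closest_point ((\<lambda>c. \<beta> t *\<^sub>R c) ` (convex hull (g (x t) ` I))) (- a t) = 0"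
        using \<open>finite I\<close> \<beta>_pos[of t] elim \<open>t0 > 0\<close> \<open>\<alpha> > 0\<close>
        by (intro convex_hull_argmax_imp_closest_point) (auto simp: W_def)
      then show ?case
        using elim by (simp add: xdot grad_hull_def g_def I_def)
    qed
  next
    show "x t0 = x0"
      by (simp add: x_def z0)
    show "vector_derivative x (at t0 within {t0..}) = v0"
      by (simp add: xdot u_def z0)
  qed
  then show ?thesis
    by blast
qed

theorem theorem3p1:
  fixes t0 \<alpha> L :: real
    and \<beta> :: "real \<Rightarrow> real"
    and m :: nat
    and f :: "nat \<Rightarrow> real ^ 'n \<Rightarrow> real"
    and x0 v0 :: "real ^ 'n"
  assumes "t0 > 0" and "\<alpha> > 0" and "L > 0" and "m \<ge> 1"
    and "\<And>t. t \<ge> t0 \<Longrightarrow> \<beta> t > 0"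
    and "continuously_differentiable_on {t0..} \<beta>"
    and "mono_on {t0..} \<beta>"
    and "\<And>i. i \<in> {1..m} \<Longrightarrow> convex_on UNIV (f i)"
    and "\<And>i y. i \<in> {1..m} \<Longrightarrow> f i differentiable (at y)"
    and "\<And>i. i \<in> {1..m} \<Longrightarrow> L-lipschitz_on UNIV (gradient (f i))"
  shows "\<exists>x. MITS_solution t0 \<alpha> \<beta> m f x0 v0 x"
proof -
  have "continuous_on {t0..} \<beta>"
    using assms(6) unfolding continuously_differentiable_on_def
    by (auto simp: continuous_on_eq_continuous_within intro: differentiable_imp_continuous_within)
  with assms show ?thesis
    by (intro MITS_solution_exists[where L = L]) auto
qed

end
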